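(* Assume $\mathcal H_o$ is infinite-dimensional. For each $m\ge1$ let $\mathcal D_m$ be a D-optimal design with $m$ measurements for the problem without model error, i.e. $$\mathcal D_m=\operatorname*{arg\,max}_{\|\mathbf o_j\|=1,\ j=1,\dots,m}\Psi(\mathcal O),\qquad \Psi(\mathcal O)=\tfrac12\log\det\big(I+\sigma^{-2}\Gamma_{\mathrm{pr}}^{1/2}\mathcal F^*\mathcal O^*\mathcal O\mathcal F\Gamma_{\mathrm{pr}}^{1/2}\big),$$ and let $C_m=\big((\mathcal F\Gamma_{\mathrm{pr}}\mathcal F^* )^{-1}+\sigma^{-2}\mathcal D_m^*\mathcal D_m\big)^{-1}$ be the covariance of the pushforward under $\mathcal F$ of the posterior arising from $\mathcal D_m$. Let $\{\lambda_i\}_{i=1}^\infty$ be the eigenvalues of $\mathcal F\Gamma_{\mathrm{pr}}\mathcal F^*$ in decreasing order, and let $\theta_i^{(m)}$ be the eigenvalue of $C_m$ on the eigenvector of $\mathcal F\Gamma_{\mathrm{pr}}\mathcal F^*$ belonging to $\lambda_i$. Then for every $i$, $$\lim_{m\to\infty}\theta_i^{(m)}=0 .$$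
   Context: $\mathcal H_p$ and $\mathcal H_o$ are separable real Hilbert spaces, $\mathcal F:\mathcal H_p\to\mathcal H_o$ is a (bounded) linear operator, $\sigma^2>0$. A measurement operator with $m$ measurements is $\mathcal O=(\mathbf o_1,\dots,\mathbf o_m)^t\in(\mathcal H_o^* )^m$, acting by $\mathcal Ou=(\mathbf o_1(u),\dots,\mathbf o_m(u))^t\in\mathbb R^m$; each $\mathbf o_j$ is identified with its Riesz representative in $\mathcal H_o$, so $\mathcal O^*e_j=\mathbf o_j$. The prior on $\mathcal H_p$ is Gaussian with positive definite covariance operator $\Gamma_{\mathrm{pr}}$ (hence trace class); data are $\mathbf d=\mathcal O\mathcal F\mathbf m+\varepsilon$ with $\varepsilon\sim\mathcal N(0,\sigma^2I_m)$ independent of $\mathbf m$, so the posterior covariance is $(\Gamma_{\mathrm{pr}}^{-1}+\sigma^{-2}\mathcal F^*\mathcal O^*\mathcal O\mathcal F)^{-1}$. The operator $\mathcal F\Gamma_{\mathrm{pr}}\mathcal F^*$ is assumed invertible (injective; in infinite dimensions the inverse is densely defined). For a D-optimal $\mathcal D_m$, the operators $\mathcal D_m^*\mathcal D_m$ and $\mathcal F\Gamma_{\mathrm{pr}}\mathcal F^*$ have a common orthonormal eigenbasis, which is therefore also an eigenbasis of $C_m$; "the eigenvector belonging to $\lambda_i$" refers to such a common eigenbasis. *)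

theory Defs
  imports "HOL-Probability.Probability" "Jordan_Normal_Form.Determinant"
begin

(* Jordan_Normal_Form reuses this symbol for the scalar product of its own vectors. *)
no_notation scalar_prod (infix "\<bullet>" 70)

text \<open>
  Throughout, a separable real Hilbert space is a type of sort
  \<open>{real_inner, polish_space}\<close>, and operators are plain functions, with \<^const>\<open>bounded_linear\<close>
  and \<^const>\<open>adjoint\<close> from the library. Boundedness makes the adjoint exist.
\<close>

definition infinite_dimensional :: "'a::real_inner itself \<Rightarrow> bool" where
  "infinite_dimensional _ \<longleftrightarrow> \<not> (\<exists>B::'a set. finite B \<and> span B = UNIV)"

definition positive_operator :: "('a::real_inner \<Rightarrow> 'a) \<Rightarrow> bool" where
  "positive_operator T \<longleftrightarrow>
     bounded_linear T \<and> (\<forall>x y. T x \<bullet> y = x \<bullet> T y) \<and> (\<forall>x. 0 \<le> T x \<bullet> x)"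

definition positive_definite_operator :: "('a::real_inner \<Rightarrow> 'a) \<Rightarrow> bool" where
  "positive_definite_operator T \<longleftrightarrow> positive_operator T \<and> (\<forall>x. x \<noteq> 0 \<longrightarrow> 0 < T x \<bullet> x)"

definition operator_sqrt :: "('a::real_inner \<Rightarrow> 'a) \<Rightarrow> ('a \<Rightarrow> 'a)" where
  "operator_sqrt T = (THE R. positive_operator R \<and> R \<circ> R = T)"

text \<open>
  \<open>M\<close> is the Gaussian measure with mean \<open>a\<close> and covariance operator \<open>\<Gamma>\<close>, given by its
  characteristic functional: every \<open>\<lambda>x. x \<bullet> v\<close> has law \<open>N(a \<bullet> v, \<Gamma> v \<bullet> v)\<close>.
  That \<open>\<Gamma>\<close> is trace class is a consequence.
\<close>
definition gaussian_measure ::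
  "'a::{real_inner, polish_space} measure \<Rightarrow> 'a \<Rightarrow> ('a \<Rightarrow> 'a) \<Rightarrow> bool" where
  "gaussian_measure M a \<Gamma> \<longleftrightarrow>
     prob_space M \<and> sets M = sets borel \<and> positive_operator \<Gamma> \<and>
     (\<forall>v. (CLINT x|M. iexp (x \<bullet> v)) = iexp (a \<bullet> v) * exp (- complex_of_real ((\<Gamma> v \<bullet> v) / 2)))"

text \<open>
  The determinant of \<open>I + K\<close> on a possibly infinite-dimensional space, for \<open>K\<close> of finite
  rank (elsewhere the value is unspecified): the determinant of the restriction of \<open>I + K\<close> to a
  finite-dimensional subspace containing the range of \<open>K\<close>, which is then invariant. The
  subspace is given by an orthonormal basis \<open>bs\<close>; the value does not depend on the choice.
\<close>
definition orthonormal_list :: "'a::real_inner list \<Rightarrow> bool" where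
  "orthonormal_list bs \<longleftrightarrow>
     (\<forall>i<length bs. \<forall>j<length bs. bs ! i \<bullet> bs ! j = (if i = j then 1 else 0))"

definition det_id_plus :: "('a::real_inner \<Rightarrow> 'a) \<Rightarrow> real" where
  "det_id_plus K = (THE d. \<exists>bs. orthonormal_list bs \<and> range K \<subseteq> span (set bs) \<and>
     d = Determinant.det (Matrix.mat (length bs) (length bs)
           (\<lambda>(i, j). bs ! i \<bullet> (bs ! j + K (bs ! j)))))"

text \<open>
  A measurement operator with \<open>m\<close> measurements is the list, of length \<open>m\<close>, of the Riesz
  representatives of its functionals. Vectors of \<open>m\<close> real data are lists of length \<open>m\<close>.
\<close>
definition measure_op :: "'o::real_inner list \<Rightarrow> 'o \<Rightarrow> real list" where
  "measure_op obs u = map (\<lambda>v. v \<bullet> u) obs"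

definition measure_adj :: "'o::real_inner list \<Rightarrow> real list \<Rightarrow> 'o" where
  "measure_adj obs y = (\<Sum>j<length obs. y ! j *\<^sub>R obs ! j)"

lemma measure_adj_adjoint:
  "(\<Sum>j<length obs. measure_op obs u ! j * y ! j) = u \<bullet> measure_adj obs y"
  by (simp add: measure_op_def measure_adj_def inner_sum_right inner_commute mult.commute)

definition is_design :: "nat \<Rightarrow> 'o::real_inner list \<Rightarrow> bool" where
  "is_design m obs \<longleftrightarrow> length obs = m \<and> (\<forall>v\<in>set obs. norm v = 1)"

definition design_objective ::
  "('p::real_inner \<Rightarrow> 'o::real_inner) \<Rightarrow> ('p \<Rightarrow> 'p) \<Rightarrow> real \<Rightarrow> 'o list \<Rightarrow> real" where
  "design_objective F \<Gamma> \<sigma> obs = 1/2 * ln (det_id_plus (\<lambda>x. (1 / \<sigma>\<^sup>2) *\<^sub>R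
     operator_sqrt \<Gamma> (adjoint F (measure_adj obs (measure_op obs (F (operator_sqrt \<Gamma> x)))))))"

definition d_optimal ::
  "('p::real_inner \<Rightarrow> 'o::real_inner) \<Rightarrow> ('p \<Rightarrow> 'p) \<Rightarrow> real \<Rightarrow> nat \<Rightarrow> 'o list \<Rightarrow> bool" where
  "d_optimal F \<Gamma> \<sigma> m obs \<longleftrightarrow> is_arg_max (design_objective F \<Gamma> \<sigma>) (is_design m) obs"

definition pushforward_cov ::
  "('p::real_inner \<Rightarrow> 'o::real_inner) \<Rightarrow> ('p \<Rightarrow> 'p) \<Rightarrow> 'o \<Rightarrow> 'o" where
  "pushforward_cov F \<Gamma> = F \<circ> \<Gamma> \<circ> adjoint F"

text \<open>
  The operator \<open>((F \<Gamma> F*)\<inverse> + \<sigma>\<^sup>-\<^sup>2 O* O)\<inverse>\<close>. The inner inverse is unbounded, with domain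
  the range of \<open>F \<Gamma> F*\<close>, so the sum has that domain and is inverted from there.
\<close>
definition posterior_pushforward_cov ::
  "('p::real_inner \<Rightarrow> 'o::real_inner) \<Rightarrow> ('p \<Rightarrow> 'p) \<Rightarrow> real \<Rightarrow> 'o list \<Rightarrow> 'o \<Rightarrow> 'o" where
  "posterior_pushforward_cov F \<Gamma> \<sigma> obs =
     the_inv_into (range (pushforward_cov F \<Gamma>))
       (\<lambda>u. the_inv (pushforward_cov F \<Gamma>) u + (1 / \<sigma>\<^sup>2) *\<^sub>R measure_adj obs (measure_op obs u))"

definition orthonormal_basis :: "(nat \<Rightarrow> 'a::real_inner) \<Rightarrow> bool" where
  "orthonormal_basis e \<longleftrightarrow>
     (\<forall>i j. e i \<bullet> e j = (if i = j then 1 else 0)) \<and> closure (span (range e)) = UNIV"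

definition is_eigenbasis :: "(nat \<Rightarrow> 'a::real_inner) \<Rightarrow> ('a \<Rightarrow> 'a) \<Rightarrow> (nat \<Rightarrow> real) \<Rightarrow> bool" where
  "is_eigenbasis e T \<mu> \<longleftrightarrow> orthonormal_basis e \<and> (\<forall>i. T (e i) = \<mu> i *\<^sub>R e i)"

end

theory Submission
  imports Defs
begin

text \<open>
  Write \<open>T = F \<Gamma> F\<^sup>*\<close>, with eigenvalues \<open>lam j\<close>, and let \<open>\<eta> j\<close> be the eigenvalues of
  \<open>D\<^sub>m\<^sup>* D\<^sub>m\<close> in the common eigenbasis. On a common eigenvector the posterior pushforward covariance
  is \<open>1 / (1 / lam i + \<eta> i / \<sigma>\<^sup>2)\<close> (\<open>posterior_pushforward_cov_eigenvalue\<close>), so the claim says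
  that an optimal design eventually measures every eigendirection arbitrarily well.

  The reason is an exchange argument. If \<open>\<theta>\<close> is the posterior variance along \<open>e i\<close> and
  \<open>q = \<theta> / \<sigma>\<^sup>2\<close>, then replacing one measurement by \<open>e i\<close> multiplies the determinant by at least
  \<open>(1 + q) (1 - s\<^sub>k)\<close>, where \<open>s\<^sub>k\<close> is the leverage score of the measurement that is dropped
  (\<open>frame_exchange\<close>). Optimality forces \<open>s\<^sub>k \<ge> q / (1 + q)\<close> for all \<open>m\<close> measurements. Yet the
  scores add up to the sum over \<open>j\<close> of \<open>(lam j * \<eta> j / \<sigma>\<^sup>2) / (1 + lam j * \<eta> j / \<sigma>\<^sup>2)\<close>, which for
  every \<open>n\<close> is at most \<open>n + lam n * m / \<sigma>\<^sup>2\<close> (\<open>optimal_exchange_bound\<close>). Dividing by \<open>m\<close> and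
  letting first \<open>m\<close> and then \<open>n\<close> grow gives \<open>q \<rightarrow> 0\<close>, provided that \<open>lam n \<rightarrow> 0\<close>.

  That the eigenvalues tend to \<open>0\<close> comes from the Gaussian prior. The vectors \<open>F\<^sup>* (e j)\<close> tend weakly
  to \<open>0\<close>, so the characteristic functional of the prior tends to \<open>1\<close> along them, and \<open>lam j\<close> is the
  prior variance in that direction (\<open>gaussian_variance_tendsto_0\<close>).

  Three objects of the statement are described by choice or unique existence and must first be shown
  to exist: the adjoint (\<open>riesz_representation\<close>), the positive square root of \<open>\<Gamma>\<close>
  (\<open>positive_operator_sqrt_unique\<close>) and the determinant of a finite-rank perturbation of the
  identity (\<open>det_id_plus_eq\<close>).
\<close>

section \<open>Riesz representation and adjoints\<close>

text \<open>
  The representative is the maximiser of the strictly concave functional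
  \<open>f x - (x \<bullet> x) / 2\<close>. The parallelogram law makes every maximising sequence Cauchy, and the
  first-order condition at the limit is the representation formula.
\<close>
lemma riesz_representation:
  fixes f :: "'a::{real_inner, complete_space} \<Rightarrow> real"
  assumes f: "bounded_linear f"
  shows "\<exists>u. \<forall>x. f x = u \<bullet> x"
proof -
  interpret f: bounded_linear f by fact
  define \<phi> where "\<phi> x = f x - (x \<bullet> x) / 2" for x
  define S where "S = (SUP x. \<phi> x)"
  obtain c where c: "\<And>x. \<bar>f x\<bar> \<le> norm x * c"
    using f.bounded by auto
  have "\<phi> x \<le> c\<^sup>2 / 2" for x
  proof -
    have "0 \<le> (norm x - c)\<^sup>2" by simp
    then have "norm x * c - (norm x)\<^sup>2 / 2 \<le> c\<^sup>2 / 2"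
      by (simp add: power2_eq_square algebra_simps)
    then show ?thesis
      using c[of x] by (simp add: \<phi>_def power2_norm_eq_inner)
  qed
  then have bdd: "bdd_above (range \<phi>)" by (auto intro!: bdd_aboveI[of _ "c\<^sup>2 / 2"] simp del: le_divide_eq_numeral1)
  have S_ub: "\<phi> x \<le> S" for x
    unfolding S_def by (rule cSUP_upper[OF _ bdd]) simp
  have parallelogram: "(dist x y)\<^sup>2 \<le> 4 * ((S - \<phi> x) + (S - \<phi> y))" for x y
  proof -
    have "\<phi> ((1/2) *\<^sub>R (x + y)) = (\<phi> x + \<phi> y) / 2 + (dist x y)\<^sup>2 / 8"
      by (simp add: \<phi>_def f.add f.scaleR dist_norm power2_norm_eq_inner inner_add_left inner_add_right
          inner_diff_left inner_diff_right inner_commute[of y x] field_simps)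
    with S_ub[of "(1/2) *\<^sub>R (x + y)"]
    have "(\<phi> x + \<phi> y) / 2 + (dist x y)\<^sup>2 / 8 \<le> S" by simp
    moreover have "d \<le> 4 * ((s - a) + (s - b))" if "(a + b) / 2 + d / 8 \<le> s" for a b d s :: real
      using that by (simp add: field_simps)
    ultimately show ?thesis by blast
  qed
  have "\<exists>x. S - inverse (real (Suc n)) < \<phi> x" for n
  proof -
    have "S - inverse (real (Suc n)) < (SUP x. \<phi> x)" by (simp add: S_def)
    then show ?thesis using bdd by (subst (asm) less_cSUP_iff) auto
  qed
  then obtain X where X: "\<And>n. S - inverse (real (Suc n)) < \<phi> (X n)" by metis
  have "Cauchy X"
  proof (rule metric_CauchyI)
    fix r :: real assume "0 < r"
    then obtain N where "inverse (real (Suc N)) < r\<^sup>2 / 8"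
      using reals_Archimedean[of "r\<^sup>2 / 8"] by auto
    then have N: "8 * inverse (real (Suc N)) < r\<^sup>2" by simp
    have "dist (X m) (X n) < r" if "N \<le> m" "N \<le> n" for m n
    proof -
      have "inverse (real (Suc m)) \<le> inverse (real (Suc N))"
        "inverse (real (Suc n)) \<le> inverse (real (Suc N))" using that by auto
      then have "(dist (X m) (X n))\<^sup>2 < r\<^sup>2"
        using parallelogram[of "X m" "X n"] X[of m] X[of n] N by argo
      then show ?thesis using \<open>0 < r\<close> by (simp add: power_less_imp_less_base)
    qed
    then show "\<exists>M. \<forall>m\<ge>M. \<forall>n\<ge>M. dist (X m) (X n) < r" by blast
  qed
  then obtain u where u: "X \<longlonglongrightarrow> u"
    using Cauchy_convergent convergent_def by blast
  have "(\<lambda>n. \<phi> (X n)) \<longlonglongrightarrow> \<phi> u"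
    unfolding \<phi>_def by (intro tendsto_intros f.tendsto u) simp
  moreover have "(\<lambda>n. S - inverse (real (Suc n))) \<longlonglongrightarrow> S - 0"
    by (intro tendsto_intros LIMSEQ_inverse_real_of_nat)
  ultimately have "S \<le> \<phi> u"
    using X by (intro LIMSEQ_le[of "\<lambda>n. S - inverse (real (Suc n))" S]) (auto intro: less_imp_le)
  then have max: "\<phi> y \<le> \<phi> u" for y using S_ub[of y] by linarith
  have "f h = u \<bullet> h" for h
  proof (cases "h = 0")
    case False
    define a where "a = f h - u \<bullet> h"
    \<comment> \<open>the maximiser of the quadratic \<open>t * a - t\<^sup>2 (h \<bullet> h) / 2\<close>\<close>
    define t where "t = a / (h \<bullet> h)"
    have "\<phi> (u + t *\<^sub>R h) = \<phi> u + (t * a - t * t * (h \<bullet> h) / 2)"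
      by (simp add: \<phi>_def a_def f.add f.scaleR inner_add_left inner_add_right inner_commute[of h u]
          field_simps)
    with max have "t * a - t * t * (h \<bullet> h) / 2 \<le> 0" by (metis add_le_same_cancel1)
    moreover have "t * a - t * t * (h \<bullet> h) / 2 = a\<^sup>2 / (2 * (h \<bullet> h))"
      using False by (simp add: t_def power2_eq_square field_simps)
    moreover have "0 < h \<bullet> h" using False by simp
    ultimately have "a\<^sup>2 \<le> 0"
      using \<open>0 < h \<bullet> h\<close> by (auto simp: divide_le_0_iff)
    then show ?thesis by (simp add: a_def)
  qed (simp add: f.zero)
  then show ?thesis by blast
qed

lemma adjoint_inner:
  fixes F :: "'a::{real_inner, complete_space} \<Rightarrow> 'b::real_inner"
  assumes "bounded_linear F"
  shows "F x \<bullet> y = x \<bullet> adjoint F y"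
proof -
  have "\<forall>y. \<exists>w. \<forall>x. F x \<bullet> y = w \<bullet> x"
    by (intro allI riesz_representation bounded_linear_compose[OF bounded_linear_inner_left assms])
  from choice[OF this] obtain G where G: "\<forall>y x. F x \<bullet> y = G y \<bullet> x" by blast
  have "\<exists>G. \<forall>x y. F x \<bullet> y = x \<bullet> G y"
  proof (intro exI[of _ G] allI)
    show "F x \<bullet> y = x \<bullet> G y" for x y
      using G inner_commute[of x "G y"] by simp
  qed
  from someI_ex[OF this] show ?thesis unfolding adjoint_def by blast
qed

section \<open>Square roots of positive operators\<close>

lemma positive_operator_nonneg: "positive_operator T \<Longrightarrow> 0 \<le> T x \<bullet> x"
  unfolding positive_operator_def by blast

lemma positive_operator_Cauchy_Schwarz:
  assumes "positive_operator T"
  shows "(T x \<bullet> y)\<^sup>2 \<le> (T x \<bullet> x) * (T y \<bullet> y)"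
proof -
  interpret bounded_linear T using assms by (simp add: positive_operator_def)
  have sym: "T y \<bullet> x = T x \<bullet> y"
    using assms by (metis inner_commute positive_operator_def)
  have quad: "0 \<le> T x \<bullet> x + 2 * t * (T x \<bullet> y) + t * t * (T y \<bullet> y)" for t
  proof -
    have "0 \<le> T (x + t *\<^sub>R y) \<bullet> (x + t *\<^sub>R y)"
      using assms unfolding positive_operator_def by blast
    then show ?thesis
      by (simp add: add scaleR inner_add_left inner_add_right sym algebra_simps)
  qed
  have nonneg: "0 \<le> T y \<bullet> y" using assms unfolding positive_operator_def by blast
  show ?thesis
  proof (cases "T y \<bullet> y = 0")
    case True
    have "T x \<bullet> y = 0"
    proof (rule ccontr)
      assume "T x \<bullet> y \<noteq> 0"
      with quad[of "- (T x \<bullet> x + 1) / (2 * (T x \<bullet> y))"] True show False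
        by (simp add: field_simps)
    qed
    with True show ?thesis by simp
  next
    case False
    with nonneg have "0 < T y \<bullet> y" by simp
    with quad[of "- (T x \<bullet> y) / (T y \<bullet> y)"] show ?thesis
      by (simp add: field_simps power2_eq_square)
  qed
qed

lemma positive_operator_eq_0:
  assumes "positive_operator T" and "T x \<bullet> x = 0"
  shows "T x = 0"
  using positive_operator_Cauchy_Schwarz[OF assms(1), of x "T x"] assms(2) by simp

text \<open>
  The square root of \<open>A = I - B\<close> is sought as \<open>I - Y\<close>, which requires \<open>Y = (B + Y\<^sup>2) / 2\<close>. The
  fixed-point iteration from \<open>0\<close> produces polynomials in \<open>B\<close>, so its limit inherits symmetry and
  every commutation relation of \<open>B\<close>.
\<close>
primrec sqrt_iterate :: "('a::real_vector \<Rightarrow> 'a) \<Rightarrow> nat \<Rightarrow> 'a \<Rightarrow> 'a" where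
  "sqrt_iterate B 0 = (\<lambda>x. 0)"
| "sqrt_iterate B (Suc n) = (\<lambda>x. (1/2) *\<^sub>R (B x + sqrt_iterate B n (sqrt_iterate B n x)))"

text \<open>
  The same iteration for the scalar \<open>B = 1\<close>. It increases to \<open>1\<close> and dominates both the norms and
  the increments of the operator iteration.
\<close>
primrec sqrt_majorant :: "nat \<Rightarrow> real" where
  "sqrt_majorant 0 = 0"
| "sqrt_majorant (Suc n) = (1 + sqrt_majorant n * sqrt_majorant n) / 2"

lemma sqrt_majorant_bounds: "0 \<le> sqrt_majorant n \<and> sqrt_majorant n \<le> 1"
proof (induction n)
  case (Suc n)
  then have "sqrt_majorant n * sqrt_majorant n \<le> 1 * 1" by (intro mult_mono) auto
  with Suc show ?case by simp
qed simp

lemma sqrt_majorant_incseq: "incseq sqrt_majorant"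
proof (rule incseq_SucI)
  fix n
  have "0 \<le> (1 - sqrt_majorant n) * (1 - sqrt_majorant n)" by simp
  then show "sqrt_majorant n \<le> sqrt_majorant (Suc n)"
    by (simp add: algebra_simps)
qed

lemma sqrt_iterate_linear: "linear B \<Longrightarrow> linear (sqrt_iterate B n)"
proof (induction n)
  case 0
  then show ?case by (simp add: linear_iff)
next
  case (Suc n)
  then have "linear (\<lambda>x. sqrt_iterate B n (sqrt_iterate B n x))"
    using linear_compose[of "sqrt_iterate B n" "sqrt_iterate B n"] by (simp add: o_def)
  with Suc.prems show ?case
    by (simp add: linear_iff scaleR_add_right algebra_simps)
qed

lemma sqrt_iterate_commute:
  assumes "linear C" and "\<And>x. C (B x) = B (C x)"
  shows "C (sqrt_iterate B n x) = sqrt_iterate B n (C x)"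
proof (induction n arbitrary: x)
  case 0
  then show ?case using assms(1) by (simp add: linear_0)
next
  case (Suc n)
  then show ?case using assms by (simp add: linear_add linear_cmul)
qed

lemma sqrt_iterate_norm:
  assumes B: "linear B" "\<And>x. norm (B x) \<le> norm x"
  shows "norm (sqrt_iterate B n x) \<le> sqrt_majorant n * norm x"
proof (induction n arbitrary: x)
  case (Suc n)
  have "norm (sqrt_iterate B n (sqrt_iterate B n x)) \<le> sqrt_majorant n * norm (sqrt_iterate B n x)"
    by (rule Suc)
  also have "\<dots> \<le> sqrt_majorant n * (sqrt_majorant n * norm x)"
    using sqrt_majorant_bounds by (intro mult_left_mono Suc) auto
  finally have "norm (B x + sqrt_iterate B n (sqrt_iterate B n x))
      \<le> norm x + sqrt_majorant n * (sqrt_majorant n * norm x)"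
    using B(2)[of x] norm_triangle_mono by blast
  then show ?case
    by (simp only: sqrt_iterate.simps norm_scaleR sqrt_majorant.simps) (simp add: field_simps)
qed simp

text \<open>
  Consecutive iterates \<open>Y\<close> and \<open>Z\<close> commute, so \<open>Z\<^sup>2 - Y\<^sup>2 = (Z + Y) (Z - Y)\<close>. The scalar
  iteration has the same factorisation, which is why it dominates the increments.
\<close>
lemma sqrt_iterate_step_norm:
  assumes B: "linear B" "\<And>x. norm (B x) \<le> norm x"
  shows "norm (sqrt_iterate B (Suc n) x - sqrt_iterate B n x)
    \<le> (sqrt_majorant (Suc n) - sqrt_majorant n) * norm x"
proof (induction n arbitrary: x)
  case 0
  then show ?case using B(2)[of x] by simp
next
  case (Suc n)
  let ?Y = "sqrt_iterate B n" and ?Z = "sqrt_iterate B (Suc n)"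
  let ?y = "sqrt_majorant n" and ?z = "sqrt_majorant (Suc n)"
  note lin = sqrt_iterate_linear[OF B(1)]
  have comm: "?Y (?Z x) = ?Z (?Y x)" for x
    by (intro sqrt_iterate_commute lin) (simp add: sqrt_iterate_commute[OF B(1)])
  let ?d = "?Z x - ?Y x"
  have split: "sqrt_iterate B (Suc (Suc n)) x - ?Z x = (1/2) *\<^sub>R (?Z ?d + ?Y ?d)"
  proof -
    have "?Z ?d + ?Y ?d = ?Z (?Z x) - ?Y (?Y x)"
      using linear_diff[OF lin, of "Suc n" "?Z x" "?Y x"] linear_diff[OF lin, of n "?Z x" "?Y x"] comm[of x]
      by simp
    then show ?thesis
      by (simp add: scaleR_diff_right[symmetric] del: sqrt_iterate.simps)
         (simp add: algebra_simps)
  qed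
  have z: "0 \<le> ?z" "0 \<le> ?y" using sqrt_majorant_bounds by auto
  have "norm (?Z ?d + ?Y ?d) \<le> norm (?Z ?d) + norm (?Y ?d)" by (rule norm_triangle_ineq)
  also have "\<dots> \<le> ?z * norm ?d + ?y * norm ?d"
    by (intro add_mono sqrt_iterate_norm B)
  also have "\<dots> = (?z + ?y) * norm ?d" by (simp add: algebra_simps)
  also have "\<dots> \<le> (?z + ?y) * ((?z - ?y) * norm x)"
    using z by (intro mult_left_mono Suc) auto
  finally have "norm (?Z ?d + ?Y ?d) \<le> (?z + ?y) * ((?z - ?y) * norm x)" .
  moreover have "(?z + ?y) * ((?z - ?y) * norm x) = 2 * ((sqrt_majorant (Suc (Suc n)) - ?z) * norm x)"
  proof -
    have "2 * sqrt_majorant (Suc (Suc n)) = 1 + ?z * ?z" "2 * ?z = 1 + ?y * ?y"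
      by simp_all
    moreover have "(?z + ?y) * ((?z - ?y) * norm x) = (?z * ?z - ?y * ?y) * norm x"
      by (simp add: algebra_simps del: sqrt_majorant.simps)
    ultimately show ?thesis by (simp add: algebra_simps del: sqrt_majorant.simps)
  qed
  ultimately show ?case
    unfolding split norm_scaleR by (simp del: sqrt_iterate.simps sqrt_majorant.simps)
qed

lemma sqrt_iterate_diff_norm:
  assumes B: "linear B" "\<And>x. norm (B x) \<le> norm x" and "m \<le> n"
  shows "norm (sqrt_iterate B n x - sqrt_iterate B m x)
    \<le> (sqrt_majorant n - sqrt_majorant m) * norm x"
  using \<open>m \<le> n\<close>
proof (induction n rule: dec_induct)
  case (step n)
  have "norm (sqrt_iterate B (Suc n) x - sqrt_iterate B m x)
    \<le> norm (sqrt_iterate B (Suc n) x - sqrt_iterate B n x)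
      + norm (sqrt_iterate B n x - sqrt_iterate B m x)"
    using norm_triangle_ineq[of "sqrt_iterate B (Suc n) x - sqrt_iterate B n x"
        "sqrt_iterate B n x - sqrt_iterate B m x"] by (simp del: sqrt_iterate.simps)
  with step.IH sqrt_iterate_step_norm[OF B, of n x]
  show ?case by (simp add: left_diff_distrib del: sqrt_iterate.simps sqrt_majorant.simps)
qed simp

lemma norm_diff_square_expand: "(norm (x - y))\<^sup>2 = (norm x)\<^sup>2 - 2 * (y \<bullet> x) + (norm y)\<^sup>2"
  by (simp add: power2_norm_eq_inner inner_diff_left inner_diff_right inner_commute)

text \<open>
  Positivity and contractivity of \<open>A\<close> make \<open>B = I - A\<close> a contraction, hence the iteration converges
  pointwise. The commutation clause is what the uniqueness proof consumes.
\<close>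
lemma positive_contraction_sqrt:
  fixes A :: "'a::{real_inner, complete_space} \<Rightarrow> 'a"
  assumes A: "positive_operator A" and contr: "\<And>x. norm (A x) \<le> norm x"
  shows "\<exists>R. positive_operator R \<and> R \<circ> R = A \<and>
    (\<forall>C. bounded_linear C \<longrightarrow> (\<forall>x. C (A x) = A (C x)) \<longrightarrow> (\<forall>x. C (R x) = R (C x)))"
proof -
  interpret A: bounded_linear A using A by (simp add: positive_operator_def)
  have symA: "A x \<bullet> y = x \<bullet> A y" for x y using A by (simp add: positive_operator_def)
  define B where "B x = x - A x" for x
  have linB: "linear B" by (rule linearI) (simp_all add: B_def A.add A.scaleR algebra_simps)
  have symB: "B x \<bullet> y = x \<bullet> B y" for x y by (simp add: B_def inner_diff_left inner_diff_right symA)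
  have normB: "norm (B x) \<le> norm x" for x
  proof -
    \<comment> \<open>Cauchy-Schwarz for the form \<open>A x \<bullet> y\<close> at \<open>y = A x\<close>\<close>
    have "norm (A x) ^ 2 \<le> A x \<bullet> x"
    proof (cases "A x = 0")
      case False
      have "(A x \<bullet> A x)\<^sup>2 \<le> (A x \<bullet> x) * (A (A x) \<bullet> A x)"
        by (rule positive_operator_Cauchy_Schwarz[OF A])
      also have "\<dots> \<le> (A x \<bullet> x) * (norm (A x) * norm (A x))"
      proof (rule mult_left_mono)
        have "A (A x) \<bullet> A x \<le> norm (A (A x)) * norm (A x)" by (rule norm_cauchy_schwarz)
        also have "\<dots> \<le> norm (A x) * norm (A x)" by (intro mult_right_mono contr) simp
        finally show "A (A x) \<bullet> A x \<le> norm (A x) * norm (A x)" .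
        show "0 \<le> A x \<bullet> x" using A unfolding positive_operator_def by blast
      qed
      finally have "(A x \<bullet> A x)\<^sup>2 \<le> (A x \<bullet> x) * (norm (A x) * norm (A x))" .
      then have "(A x \<bullet> A x) * (A x \<bullet> A x) \<le> (A x \<bullet> x) * (A x \<bullet> A x)"
        by (simp add: power2_eq_square flip: power2_norm_eq_inner)
      then show ?thesis using False by (simp add: power2_norm_eq_inner)
    qed (simp)
    moreover have "0 \<le> A x \<bullet> x" by (rule positive_operator_nonneg[OF A])
    moreover have "(norm (B x))\<^sup>2 = (norm x)\<^sup>2 - 2 * (A x \<bullet> x) + (norm (A x))\<^sup>2"
      unfolding B_def by (rule norm_diff_square_expand)
    ultimately have "(norm (B x))\<^sup>2 \<le> (norm x)\<^sup>2" by linarith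
    then show ?thesis by (rule power2_le_imp_le) simp
  qed
  let ?Y = "sqrt_iterate B"
  have bound1: "norm (?Y n x) \<le> norm x" for n x
    using sqrt_iterate_norm[OF linB normB, of n x] sqrt_majorant_bounds[of n]
      mult_right_mono[of "sqrt_majorant n" 1 "norm x"] by simp
  obtain l where l: "sqrt_majorant \<longlonglongrightarrow> l" "\<forall>i. sqrt_majorant i \<le> l"
    using incseq_convergent[OF sqrt_majorant_incseq, of 1] sqrt_majorant_bounds by blast
  have "Cauchy (\<lambda>n. ?Y n x)" for x
  proof (rule metric_CauchyI)
    fix r :: real assume "0 < r"
    then have "0 < r / (norm x + 1)" by (simp add: add_nonneg_pos)
    then obtain N where N: "\<And>n. n \<ge> N \<Longrightarrow> \<bar>sqrt_majorant n - l\<bar> < r / (norm x + 1)"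
      using LIMSEQ_D[OF l(1), of "r / (norm x + 1)"] by auto
    have le: "dist (?Y n x) (?Y m x) < r" if "N \<le> m" "m \<le> n" for m n
    proof -
      have "sqrt_majorant n - sqrt_majorant m \<le> r / (norm x + 1)"
        using N[OF that(1)] l(2)[rule_format, of n] by linarith
      then have "norm (?Y n x - ?Y m x) \<le> r / (norm x + 1) * norm x"
        using sqrt_iterate_diff_norm[OF linB normB that(2), of x]
          mult_right_mono[OF _ norm_ge_zero[of x]] order_trans by blast
      also have "\<dots> < r"
        using \<open>0 < r\<close> by (simp add: pos_divide_less_eq add_nonneg_pos)
      finally show ?thesis by (simp add: dist_norm)
    qed
    then have "dist (?Y m x) (?Y n x) < r" if "N \<le> m" "N \<le> n" for m n
      using that by (metis dist_commute nat_le_linear)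
    then show "\<exists>M. \<forall>m\<ge>M. \<forall>n\<ge>M. dist (?Y m x) (?Y n x) < r" by blast
  qed
  then have "\<exists>y. (\<lambda>n. ?Y n x) \<longlonglongrightarrow> y" for x
    using Cauchy_convergent convergent_def by blast
  then obtain Y where Y: "\<And>x. (\<lambda>n. ?Y n x) \<longlonglongrightarrow> Y x" by metis
  have normY: "norm (Y x) \<le> norm x" for x
    by (rule Lim_bounded[OF tendsto_norm[OF Y]]) (simp add: bound1)
  note linYn = sqrt_iterate_linear[OF linB]
  have addY: "Y (x + y) = Y x + Y y" for x y
    using Y[of "x + y"] tendsto_add[OF Y[of x] Y[of y]]
    by (intro LIMSEQ_unique) (simp_all add: linear_add[OF linYn])
  have scaleY: "Y (r *\<^sub>R x) = r *\<^sub>R Y x" for r x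
    using Y[of "r *\<^sub>R x"] tendsto_scaleR[OF tendsto_const Y[of x]]
    by (intro LIMSEQ_unique) (simp_all add: linear_cmul[OF linYn])
  have blY: "bounded_linear Y"
    by (rule bounded_linear_intro[of _ 1]) (simp_all add: addY scaleY normY)
  interpret Y: bounded_linear Y by fact
  have symYn: "?Y n x \<bullet> y = x \<bullet> ?Y n y" for n x y
  proof (induction n arbitrary: x y)
    case (Suc n)
    have "?Y n (?Y n x) \<bullet> y = x \<bullet> ?Y n (?Y n y)" by (simp only: Suc)
    then show ?case by (simp add: inner_add_left inner_add_right symB)
  qed simp
  have symY: "Y x \<bullet> y = x \<bullet> Y y" for x y
    using tendsto_inner[OF Y[of x] tendsto_const[of y]] tendsto_inner[OF tendsto_const[of x] Y[of y]]
    by (intro LIMSEQ_unique[of "\<lambda>n. ?Y n x \<bullet> y"]) (simp_all add: symYn)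
  have fixY: "2 *\<^sub>R Y x = B x + Y (Y x)" for x
  proof -
    have "(\<lambda>n. ?Y n (?Y n x - Y x)) \<longlonglongrightarrow> 0"
    proof (rule Lim_null_comparison)
      show "\<forall>\<^sub>F n in sequentially. norm (?Y n (?Y n x - Y x)) \<le> norm (?Y n x - Y x)"
        by (simp add: bound1)
      show "(\<lambda>n. norm (?Y n x - Y x)) \<longlonglongrightarrow> 0"
        using Y[of x] by (simp add: LIM_zero_iff tendsto_norm_zero_iff)
    qed
    from tendsto_add[OF this Y[of "Y x"]] have "(\<lambda>n. ?Y n (?Y n x)) \<longlonglongrightarrow> Y (Y x)"
      by (simp add: linear_diff[OF linYn])
    then have "(\<lambda>n. 2 *\<^sub>R ?Y (Suc n) x) \<longlonglongrightarrow> B x + Y (Y x)"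
      by (simp add: tendsto_add)
    moreover have "(\<lambda>n. 2 *\<^sub>R ?Y (Suc n) x) \<longlonglongrightarrow> 2 *\<^sub>R Y x"
      by (intro tendsto_intros LIMSEQ_Suc Y)
    ultimately show ?thesis using LIMSEQ_unique by blast
  qed
  define R where "R = (\<lambda>x. x - Y x)"
  have "positive_operator R"
    unfolding positive_operator_def
  proof (intro conjI allI)
    show "bounded_linear R" unfolding R_def
      by (intro bounded_linear_sub bounded_linear_ident blY)
    show "R x \<bullet> y = x \<bullet> R y" for x y by (simp add: R_def inner_diff_left inner_diff_right symY)
    have "Y x \<bullet> x \<le> norm x * norm x" for x
      using norm_cauchy_schwarz[of "Y x" x] mult_right_mono[OF normY[of x] norm_ge_zero[of x]] by linarith
    then show "0 \<le> R x \<bullet> x" for x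
      by (simp add: R_def inner_diff_left flip: power2_norm_eq_inner) (simp add: power2_eq_square)
  qed
  moreover have "R \<circ> R = A"
  proof
    fix x show "(R \<circ> R) x = A x"
      using fixY[of x] by (simp add: R_def B_def Y.diff algebra_simps scaleR_2)
  qed
  moreover have "C (R x) = R (C x)" if C: "bounded_linear C" "\<forall>x. C (A x) = A (C x)" for C x
  proof -
    interpret C: bounded_linear C by fact
    have "C (?Y n x) = ?Y n (C x)" for n
      by (rule sqrt_iterate_commute) (simp_all add: C.linear B_def C.diff C(2))
    then have "C (Y x) = Y (C x)"
      using C.tendsto[OF Y[of x]] Y[of "C x"] LIMSEQ_unique by simp
    then show ?thesis by (simp add: R_def C.diff)
  qed
  ultimately show ?thesis by blast
qed

lemma positive_operator_sqrt_exists: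
  fixes T :: "'a::{real_inner, complete_space} \<Rightarrow> 'a"
  assumes T: "positive_operator T"
  shows "\<exists>R. positive_operator R \<and> R \<circ> R = T \<and>
    (\<forall>C. bounded_linear C \<longrightarrow> (\<forall>x. C (T x) = T (C x)) \<longrightarrow> (\<forall>x. C (R x) = R (C x)))"
proof -
  have blT: "bounded_linear T" using T by (simp add: positive_operator_def)
  obtain c where c: "0 < c" "\<And>x. norm (T x) \<le> norm x * c"
    using bounded_linear.pos_bounded[OF blT] by blast
  define A where "A = (\<lambda>x. (1 / c) *\<^sub>R T x)"
  have "positive_operator A"
    using T c(1) by (auto simp: A_def positive_operator_def bounded_linear_const_scaleR)
  moreover have "norm (A x) \<le> norm x" for x
    using c by (simp add: A_def field_simps)
  ultimately obtain S where S: "positive_operator S" "S \<circ> S = A"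
    "\<forall>C. bounded_linear C \<longrightarrow> (\<forall>x. C (A x) = A (C x)) \<longrightarrow> (\<forall>x. C (S x) = S (C x))"
    using positive_contraction_sqrt[of A] by blast
  interpret S: bounded_linear S using S(1) by (simp add: positive_operator_def)
  define R where "R = (\<lambda>x. sqrt c *\<^sub>R S x)"
  have "positive_operator R"
    using S(1) c(1) by (auto simp: R_def positive_operator_def bounded_linear_const_scaleR)
  moreover have "R \<circ> R = T"
  proof
    fix x
    have "S (S x) = (1 / c) *\<^sub>R T x" using S(2) by (auto simp: A_def fun_eq_iff)
    then show "(R \<circ> R) x = T x" using c(1) by (simp add: R_def S.scaleR)
  qed
  moreover have "C (R x) = R (C x)" if C: "bounded_linear C" "\<forall>x. C (T x) = T (C x)" for C x
  proof -
    interpret C: bounded_linear C by fact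
    show ?thesis using S(3) C by (simp add: R_def A_def C.scaleR)
  qed
  ultimately show ?thesis by blast
qed

text \<open>
  Any other positive root \<open>S\<close> commutes with \<open>T = S\<^sup>2\<close>, hence with the constructed root \<open>R\<close>. Then
  \<open>(S + R) (S - R) = 0\<close>, and positivity of both summands forces \<open>S\<close> and \<open>R\<close> to vanish on the
  range of \<open>S - R\<close>, so \<open>(S - R)\<^sup>2 = 0\<close>.
\<close>
lemma positive_operator_sqrt_unique:
  fixes T :: "'a::{real_inner, complete_space} \<Rightarrow> 'a"
  assumes T: "positive_operator T"
  shows "\<exists>!R. positive_operator R \<and> R \<circ> R = T"
proof -
  obtain R where R: "positive_operator R" "R \<circ> R = T"
    and R_comm: "\<forall>C. bounded_linear C \<longrightarrow> (\<forall>x. C (T x) = T (C x)) \<longrightarrow> (\<forall>x. C (R x) = R (C x))"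
    using positive_operator_sqrt_exists[OF T] by blast
  have RR: "R (R x) = T x" for x using R(2) by (auto simp: fun_eq_iff)
  have "S = R" if S: "positive_operator S" "S \<circ> S = T" for S
  proof
    fix x
    have SS: "S (S x) = T x" for x using S(2) by (auto simp: fun_eq_iff)
    interpret S: bounded_linear S using S(1) by (simp add: positive_operator_def)
    interpret R: bounded_linear R using R(1) by (simp add: positive_operator_def)
    have comm: "S (R x) = R (S x)" for x
      using R_comm S.bounded_linear_axioms by (simp flip: SS)
    define y where "y = S x - R x"
    have "S y + R y = 0" by (simp add: y_def S.diff R.diff comm SS RR)
    then have "S y \<bullet> y + R y \<bullet> y = 0" by (metis inner_add_left inner_zero_left)
    moreover note positive_operator_nonneg[OF S(1), of y] positive_operator_nonneg[OF R(1), of y]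
    ultimately have "S y = 0" "R y = 0"
      using S(1) R(1) by (auto intro: positive_operator_eq_0)
    moreover have "y \<bullet> y = x \<bullet> (S y - R y)"
      using S(1) R(1) unfolding positive_operator_def
      by (subst y_def) (simp add: inner_diff_left inner_diff_right)
    ultimately show "S x = R x" by (simp add: y_def)
  qed
  with R show ?thesis by blast
qed

lemma operator_sqrt:
  fixes T :: "'a::{real_inner, complete_space} \<Rightarrow> 'a"
  assumes "positive_operator T"
  shows "positive_operator (operator_sqrt T)" and "operator_sqrt T (operator_sqrt T x) = T x"
proof -
  have "positive_operator (operator_sqrt T) \<and> operator_sqrt T \<circ> operator_sqrt T = T"
    unfolding operator_sqrt_def by (rule theI'[OF positive_operator_sqrt_unique[OF assms]])
  then show "positive_operator (operator_sqrt T)" "operator_sqrt T (operator_sqrt T x) = T x"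
    by (auto simp: fun_eq_iff)
qed

section \<open>Determinants of finite-rank perturbations of the identity\<close>

text \<open>
  Both determinants equal that of the block matrix with blocks \<open>I, -X, Y, I\<close>: multiplying it by a
  unipotent block matrix on the right or on the left eliminates the block \<open>-X\<close>.
\<close>
lemma Sylvester_determinant_identity:
  fixes X Y :: "'a::idom Matrix.mat"
  assumes X: "X \<in> carrier_mat n m" and Y: "Y \<in> carrier_mat m n"
  shows "Determinant.det (1\<^sub>m n + X * Y) = Determinant.det (1\<^sub>m m + Y * X)"
proof -
  define M where "M = four_block_mat (1\<^sub>m n) (- X) Y (1\<^sub>m m)"
  define U where "U = four_block_mat (1\<^sub>m n) X (0\<^sub>m m n) (1\<^sub>m m)"
  have carrier: "M \<in> carrier_mat (n + m) (n + m)" "U \<in> carrier_mat (n + m) (n + m)"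
    using X Y by (auto simp: M_def U_def)
  have nX: "- X \<in> carrier_mat n m" using X by simp
  have XY: "X * Y \<in> carrier_mat n n" "Y * X \<in> carrier_mat m m" using X Y by auto
  have "M * U = four_block_mat (1\<^sub>m n) (0\<^sub>m n m) Y (1\<^sub>m m + Y * X)"
    unfolding M_def U_def using X Y nX XY
    by (subst mult_four_block_mat[OF _ nX Y _ _ X]) (auto simp: comm_add_mat)
  then have "Determinant.det (M * U) = Determinant.det (1\<^sub>m m + Y * X)"
    using X Y XY by (simp add: det_four_block_mat_upper_right_zero[of _ n _ m])
  moreover have "U * M = four_block_mat (1\<^sub>m n + X * Y) (0\<^sub>m n m) Y (1\<^sub>m m)"
    unfolding M_def U_def using X Y nX XY
    by (subst mult_four_block_mat[OF _ X _ _ _ nX Y]) (auto simp: comm_add_mat)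
  then have "Determinant.det (U * M) = Determinant.det (1\<^sub>m n + X * Y)"
    using X Y XY by (simp add: det_four_block_mat_upper_right_zero[of _ n _ m])
  ultimately show ?thesis
    using det_mult[OF carrier] det_mult[OF carrier(2,1)] by (simp add: mult.commute)
qed

lemma index_mult_mat_of_funs:
  "i < n \<Longrightarrow> j < m \<Longrightarrow> (Matrix.mat n k f * Matrix.mat k m g) $$ (i, j) = (\<Sum>l<k. f (i, l) * g (l, j))"
  by (simp add: scalar_prod_def lessThan_atLeast0)

text \<open>
  Factoring out the diagonal leaves \<open>I\<close> plus a matrix of rank one, and Sylvester's identity reduces
  its determinant to a number.
\<close>
lemma det_diagonal_minus_rank_one:
  fixes a g :: "nat \<Rightarrow> 'a::field"
  assumes a: "\<And>i. i < n \<Longrightarrow> a i \<noteq> 0"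
  shows "Determinant.det (Matrix.mat n n (\<lambda>(i, j). (if i = j then a i else 0) - g i * g j))
    = (\<Prod>i<n. a i) * (1 - (\<Sum>i<n. g i * g i / a i))"
proof -
  define D where "D = Matrix.mat n n (\<lambda>(i, j). if i = j then a i else 0)"
  define X where "X = Matrix.mat n 1 (\<lambda>(i, j). - g i / a i)"
  define Y where "Y = Matrix.mat 1 n (\<lambda>(i, j). g j)"
  have carrier: "D \<in> carrier_mat n n" "X \<in> carrier_mat n 1" "Y \<in> carrier_mat 1 n"
    by (simp_all add: D_def X_def Y_def)
  have "Matrix.mat n n (\<lambda>(i, j). (if i = j then a i else 0) - g i * g j) = D * (1\<^sub>m n + X * Y)"
  proof (rule eq_matI)
    fix i j assume "i < dim_row (D * (1\<^sub>m n + X * Y))" "j < dim_col (D * (1\<^sub>m n + X * Y))"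
    then have ij: "i < n" "j < n" using carrier by auto
    have XY: "1\<^sub>m n + X * Y = Matrix.mat n n (\<lambda>(i, j). (if i = j then 1 else 0) - g i / a i * g j)"
      by (rule eq_matI) (auto simp: X_def Y_def scalar_prod_def)
    have "(D * (1\<^sub>m n + X * Y)) $$ (i, j)
        = (\<Sum>l<n. (if i = l then a i else 0) * ((if l = j then 1 else 0) - g l / a l * g j))"
      unfolding XY D_def using ij by (subst index_mult_mat_of_funs) auto
    also have "\<dots> = (\<Sum>l<n. if i = l then a i * ((if i = j then 1 else 0) - g i / a i * g j) else 0)"
      by (rule sum.cong) auto
    also have "\<dots> = (if i = j then a i else 0) - g i * g j"
      using ij a[of i] by (auto simp: algebra_simps)
    finally show "Matrix.mat n n (\<lambda>(i, j). (if i = j then a i else 0) - g i * g j) $$ (i, j)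
        = (D * (1\<^sub>m n + X * Y)) $$ (i, j)" using ij by simp
  qed (use carrier in auto)
  moreover have "Determinant.det D = (\<Prod>i<n. a i)"
    by (subst det_upper_triangular[OF _ carrier(1)])
      (auto simp: D_def diag_mat_def upper_triangular_def prod.list_conv_set_nth lessThan_atLeast0)
  moreover have "Determinant.det (1\<^sub>m 1 + Y * X) = 1 - (\<Sum>i<n. g i * g i / a i)"
    using carrier
    by (subst det_single) (auto simp: X_def Y_def scalar_prod_def lessThan_atLeast0 sum_negf)
  moreover have "Determinant.det (1\<^sub>m n + X * Y) = Determinant.det (1\<^sub>m 1 + Y * X)"
    by (rule Sylvester_determinant_identity[OF carrier(2,3)])
  moreover have "1\<^sub>m n + X * Y \<in> carrier_mat n n" using carrier by auto
  ultimately show ?thesis using det_mult[OF carrier(1)] by simp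
qed

lemma orthonormal_list_expansion:
  assumes on: "orthonormal_list bs" and x: "x \<in> span (set bs)"
  shows "x = (\<Sum>l<length bs. (bs ! l \<bullet> x) *\<^sub>R bs ! l)"
  using x
proof (induction rule: span_induct_alt)
  case (step c b y)
  then obtain k where k: "k < length bs" "b = bs ! k" by (auto simp: in_set_conv_nth)
  have "(\<Sum>l<length bs. (bs ! l \<bullet> b) *\<^sub>R bs ! l) = (\<Sum>l<length bs. if l = k then b else 0)"
    using on k by (intro sum.cong) (auto simp: orthonormal_list_def)
  then have "(\<Sum>l<length bs. (bs ! l \<bullet> b) *\<^sub>R bs ! l) = b" using k by simp
  then show ?case using step
    by (simp add: inner_add_right scaleR_add_left sum.distrib flip: scaleR_scaleR scaleR_sum_right)
qed simp

lemma orthonormal_list_Parseval: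
  assumes on: "orthonormal_list bs" and x: "x \<in> span (set bs)"
  shows "y \<bullet> x = (\<Sum>l<length bs. (y \<bullet> bs ! l) * (bs ! l \<bullet> x))"
  by (subst orthonormal_list_expansion[OF assms])
    (simp add: inner_sum_right mult.commute)

text \<open>
  For two lists whose spans contain the range of \<open>K\<close>, let \<open>P\<close> hold the inner products between the
  lists and let \<open>X\<close> hold the matrix elements of \<open>K\<close> between them. Their matrices are \<open>I + P X\<close> and
  \<open>I + X P\<close>; symmetry of \<open>K\<close> enters in the second. Sylvester's identity therefore shows that the
  determinant does not depend on the list.
\<close>
lemma det_id_plus_eq:
  fixes K :: "'a::real_inner \<Rightarrow> 'a"
  assumes sym: "\<And>x y. K x \<bullet> y = x \<bullet> K y"
    and on: "orthonormal_list bs" and range: "range K \<subseteq> span (set bs)"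
  shows "det_id_plus K = Determinant.det (Matrix.mat (length bs) (length bs)
           (\<lambda>(i, j). (if i = j then 1 else 0) + bs ! i \<bullet> K (bs ! j)))"
proof -
  let ?M = "\<lambda>cs. Matrix.mat (length cs) (length cs) (\<lambda>(i, j). cs ! i \<bullet> (cs ! j + K (cs ! j)))"
  have independent_of_list: "Determinant.det (?M bs) = Determinant.det (?M cs)"
    if bs: "orthonormal_list bs" "range K \<subseteq> span (set bs)"
      and cs: "orthonormal_list cs" "range K \<subseteq> span (set cs)" for bs cs
  proof -
    let ?n = "length bs" and ?m = "length cs"
    define P where "P = Matrix.mat ?n ?m (\<lambda>(i, l). bs ! i \<bullet> cs ! l)"
    define X where "X = Matrix.mat ?m ?n (\<lambda>(l, j). cs ! l \<bullet> K (bs ! j))"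
    have "?M bs = 1\<^sub>m ?n + P * X"
    proof (rule eq_matI)
      fix i j assume "i < dim_row (1\<^sub>m ?n + P * X)" "j < dim_col (1\<^sub>m ?n + P * X)"
      then have ij: "i < ?n" "j < ?n" by (auto simp: P_def X_def)
      have "(P * X) $$ (i, j) = bs ! i \<bullet> K (bs ! j)"
        unfolding P_def X_def using ij cs
        by (subst index_mult_mat_of_funs) (auto intro!: orthonormal_list_Parseval[symmetric])
      then show "?M bs $$ (i, j) = (1\<^sub>m ?n + P * X) $$ (i, j)"
        using ij bs by (simp add: P_def X_def orthonormal_list_def inner_add_right)
    qed (simp_all add: P_def X_def)
    moreover have "?M cs = 1\<^sub>m ?m + X * P"
    proof (rule eq_matI)
      fix i j assume "i < dim_row (1\<^sub>m ?m + X * P)" "j < dim_col (1\<^sub>m ?m + X * P)"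
      then have ij: "i < ?m" "j < ?m" by (auto simp: P_def X_def)
      have "(X * P) $$ (i, j) = (\<Sum>l<?n. (cs ! i \<bullet> K (bs ! l)) * (bs ! l \<bullet> cs ! j))"
        unfolding P_def X_def using ij by (subst index_mult_mat_of_funs) auto
      also have "\<dots> = (\<Sum>l<?n. (cs ! j \<bullet> bs ! l) * (bs ! l \<bullet> K (cs ! i)))"
        by (intro sum.cong refl) (metis inner_commute mult.commute sym)
      also have "\<dots> = cs ! j \<bullet> K (cs ! i)"
        using bs by (intro orthonormal_list_Parseval[symmetric]) auto
      finally have "(X * P) $$ (i, j) = cs ! i \<bullet> K (cs ! j)" by (metis inner_commute sym)
      then show "?M cs $$ (i, j) = (1\<^sub>m ?m + X * P) $$ (i, j)"
        using ij cs by (simp add: P_def X_def orthonormal_list_def inner_add_right)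
    qed (simp_all add: P_def X_def)
    ultimately show ?thesis
      using Sylvester_determinant_identity[of P ?n ?m X] by (simp add: P_def X_def)
  qed
  have "det_id_plus K = Determinant.det (?M bs)"
    unfolding det_id_plus_def
    by (rule the_equality) (use on range independent_of_list in blast)+
  also have "?M bs = Matrix.mat (length bs) (length bs)
           (\<lambda>(i, j). (if i = j then 1 else 0) + bs ! i \<bullet> K (bs ! j))"
    using on by (intro eq_matI) (auto simp: orthonormal_list_def inner_add_right)
  finally show ?thesis .
qed

section \<open>Orthonormal systems\<close>

lemma Bessel_inequality:
  fixes e :: "'i \<Rightarrow> 'a::real_inner"
  assumes on: "\<And>i j. e i \<bullet> e j = (if i = j then 1 else 0)" and J: "finite J"
  shows "(\<Sum>j\<in>J. (x \<bullet> e j)\<^sup>2) \<le> (norm x)\<^sup>2"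
proof -
  define p where "p = (\<Sum>j\<in>J. (x \<bullet> e j) *\<^sub>R e j)"
  have "x \<bullet> p = (\<Sum>j\<in>J. (x \<bullet> e j)\<^sup>2)"
    by (simp add: p_def inner_sum_right power2_eq_square)
  moreover have "p \<bullet> p = (\<Sum>j\<in>J. (x \<bullet> e j)\<^sup>2)"
  proof -
    have "p \<bullet> e j = x \<bullet> e j" if "j \<in> J" for j
    proof -
      have "p \<bullet> e j = (\<Sum>i\<in>J. if i = j then x \<bullet> e j else 0)"
        unfolding p_def inner_sum_left by (intro sum.cong) (auto simp: on)
      then show ?thesis using that J by simp
    qed
    moreover have "p \<bullet> p = (\<Sum>j\<in>J. (x \<bullet> e j) * (p \<bullet> e j))"
      by (subst (2) p_def) (simp add: inner_sum_right)
    ultimately show ?thesis by (simp add: power2_eq_square)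
  qed
  moreover have "0 \<le> (x - p) \<bullet> (x - p)" by simp
  ultimately show ?thesis
    by (simp add: power2_norm_eq_inner inner_diff_left inner_diff_right inner_commute)
qed

lemma orthonormal_weakly_null:
  fixes e :: "nat \<Rightarrow> 'a::real_inner"
  assumes on: "\<And>i j. e i \<bullet> e j = (if i = j then 1 else 0)"
  shows "(\<lambda>j. x \<bullet> e j) \<longlonglongrightarrow> 0"
proof -
  have "summable (\<lambda>j. (x \<bullet> e j)\<^sup>2)"
    by (rule summableI_nonneg_bounded[of _ "(norm x)\<^sup>2"]) (simp_all add: Bessel_inequality on)
  from summable_LIMSEQ_zero[OF this] show ?thesis
    by (simp add: power_tendsto_0_iff)
qed

text \<open>
  The remainder is orthogonal to every basis vector, hence to the closure of their span.
\<close>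
lemma orthonormal_basis_finite_expansion:
  assumes e: "orthonormal_basis e" and J: "finite J" and supp: "\<And>j. j \<notin> J \<Longrightarrow> x \<bullet> e j = 0"
  shows "x = (\<Sum>j\<in>J. (x \<bullet> e j) *\<^sub>R e j)"
proof -
  have on: "e i \<bullet> e j = (if i = j then 1 else 0)" for i j
    using e by (simp add: orthonormal_basis_def)
  define d where "d = x - (\<Sum>j\<in>J. (x \<bullet> e j) *\<^sub>R e j)"
  have "d \<bullet> e j = 0" for j
  proof -
    have "(\<Sum>i\<in>J. (x \<bullet> e i) *\<^sub>R e i) \<bullet> e j = (\<Sum>i\<in>J. if i = j then x \<bullet> e j else 0)"
      unfolding inner_sum_left by (intro sum.cong) (auto simp: on)
    then show ?thesis using supp[of j] J by (simp add: d_def inner_diff_left)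
  qed
  then have "range e \<subseteq> {y. d \<bullet> y = 0}" by auto
  then have "span (range e) \<subseteq> {y. d \<bullet> y = 0}"
    by (rule span_minimal) (auto simp: subspace_def inner_add_right)
  then have "closure (span (range e)) \<subseteq> {y. d \<bullet> y = 0}"
    by (rule closure_minimal) (rule closed_hyperplane)
  then have "d \<in> {y. d \<bullet> y = 0}" using e unfolding orthonormal_basis_def by blast
  then show ?thesis by (simp add: d_def)
qed

section \<open>Gaussian variances along weakly null sequences\<close>

text \<open>
  The characteristic functional along \<open>v j\<close> tends to \<open>1\<close> by dominated convergence, and its modulus
  is \<open>exp (- (\<Gamma> (v j) \<bullet> v j) / 2)\<close>. Without a Gaussian measure the identity operator and an
  orthonormal sequence \<open>v\<close> would be a counterexample.
\<close>
lemma gaussian_variance_tendsto_0: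
  fixes v :: "nat \<Rightarrow> 'a::{real_inner, polish_space}"
  assumes M: "gaussian_measure M a \<Gamma>" and v: "\<And>x. (\<lambda>j. x \<bullet> v j) \<longlonglongrightarrow> 0"
  shows "(\<lambda>j. \<Gamma> (v j) \<bullet> v j) \<longlonglongrightarrow> 0"
proof -
  interpret prob_space M using M by (simp add: gaussian_measure_def)
  have meas: "f \<in> borel_measurable M" if "continuous_on UNIV f" for f :: "'a \<Rightarrow> complex"
  proof -
    have "sets M = sets borel" using M by (simp add: gaussian_measure_def)
    with borel_measurable_continuous_onI[OF that] show ?thesis
      using measurable_cong_sets by blast
  qed
  have "(\<lambda>j. CLINT x|M. iexp (x \<bullet> v j)) \<longlonglongrightarrow> (CLINT x|M. 1)"
  proof (rule integral_dominated_convergence[where w = "\<lambda>_. 1"])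
    show "(\<lambda>x. iexp (x \<bullet> v j)) \<in> borel_measurable M" for j
      by (intro meas continuous_intros)
    have "(\<lambda>j. iexp (x \<bullet> v j)) \<longlonglongrightarrow> exp (\<i> * complex_of_real 0)" for x
      by (intro tendsto_intros v)
    then show "AE x in M. (\<lambda>j. iexp (x \<bullet> v j)) \<longlonglongrightarrow> 1" by simp
  qed (auto)
  then have "(\<lambda>j. norm (CLINT x|M. iexp (x \<bullet> v j))) \<longlonglongrightarrow> norm (CLINT x|M. 1)"
    by (rule tendsto_norm)
  moreover have "norm (CLINT x|M. iexp (x \<bullet> v j)) = exp (- ((\<Gamma> (v j) \<bullet> v j) / 2))" for j
  proof -
    have "(CLINT x|M. iexp (x \<bullet> v j))
        = iexp (a \<bullet> v j) * exp (- complex_of_real ((\<Gamma> (v j) \<bullet> v j) / 2))"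
      using M unfolding gaussian_measure_def by blast
    then show ?thesis by (simp only: norm_mult norm_exp_eq_Re) simp
  qed
  moreover have "norm (CLINT x|M. 1) = 1"
    using prob_space by simp
  ultimately have "(\<lambda>j. exp (- ((\<Gamma> (v j) \<bullet> v j) / 2))) \<longlonglongrightarrow> 1" by simp
  from tendsto_ln[OF this] have "(\<lambda>j. - ((\<Gamma> (v j) \<bullet> v j) / 2)) \<longlonglongrightarrow> 0" by simp
  from tendsto_mult_left[OF this, of "-2"] show ?thesis by simp
qed

section \<open>Exchanging one vector of a frame\<close>

text \<open>
  The operator \<open>c G\<^sup>* G\<close> for the analysis map \<open>G x = (gs ! k \<bullet> x)\<close> indexed by \<open>k\<close>; the design
  objective is the determinant of the identity plus such an operator.
\<close>
definition frame_operator :: "real \<Rightarrow> 'a::real_inner list \<Rightarrow> 'a \<Rightarrow> 'a" where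
  "frame_operator c gs x = c *\<^sub>R (\<Sum>k<length gs. (gs ! k \<bullet> x) *\<^sub>R gs ! k)"

lemma inner_frame_operator:
  "y \<bullet> frame_operator c gs x = c * (\<Sum>k<length gs. (gs ! k \<bullet> x) * (gs ! k \<bullet> y))"
  by (simp add: frame_operator_def inner_sum_right inner_commute)

lemma det_id_plus_frame_operator:
  assumes "orthonormal_list bs" and "set gs \<subseteq> span (set bs)"
  shows "det_id_plus (frame_operator c gs) = Determinant.det (Matrix.mat (length bs) (length bs)
    (\<lambda>(i, j). (if i = j then 1 else 0) + c * (\<Sum>k<length gs. (gs ! k \<bullet> bs ! i) * (gs ! k \<bullet> bs ! j))))"
proof -
  have "frame_operator c gs x \<in> span (set bs)" for x
    unfolding frame_operator_def
    using assms(2) by (intro span_scale span_sum) (auto simp: subset_iff)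
  moreover have "frame_operator c gs x \<bullet> y = x \<bullet> frame_operator c gs y" for x y
    by (subst inner_commute) (simp add: inner_frame_operator mult.commute)
  ultimately show ?thesis using assms(1)
    by (subst det_id_plus_eq[of _ bs])
      (auto simp: inner_frame_operator mult.commute)
qed

text \<open>
  Replace \<open>gs ! k\<close> by a multiple of the basis vector \<open>bs ! i\<close>. In a basis that diagonalises the
  operator the new matrix is a diagonal matrix minus a rank-one matrix, where the diagonal entry at
  \<open>i\<close> has grown by the factor \<open>1 + q\<close>. With \<open>s\<close> denoting the sum in the conclusion, the
  determinant changes at least by the factor \<open>(1 + q) (1 - s)\<close>. If the exchange does not increase
  the determinant, this factor is at most \<open>1\<close>. For \<open>s \<ge> 1\<close> the conclusion holds trivially, so the
  junk values of the logarithm at nonpositive arguments do no harm.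
\<close>
lemma frame_exchange:
  fixes gs bs :: "'a::real_inner list"
  assumes c: "0 < c" and bs: "orthonormal_list bs" and gs: "set gs \<subseteq> span (set bs)"
    and diag: "\<And>p q. p < length bs \<Longrightarrow> q < length bs \<Longrightarrow>
      c * (\<Sum>k<length gs. (gs ! k \<bullet> bs ! p) * (gs ! k \<bullet> bs ! q)) = (if p = q then \<rho> p else 0)"
    and k: "k < length gs" and i: "i < length bs"
    and opt: "ln (det_id_plus (frame_operator c (gs[k := \<alpha> *\<^sub>R bs ! i])))
      \<le> ln (det_id_plus (frame_operator c gs))"
  defines "q \<equiv> c * \<alpha>\<^sup>2 / (1 + \<rho> i)"
  shows "q \<le> (1 + q) * (\<Sum>p<length bs. c * (gs ! k \<bullet> bs ! p)\<^sup>2 / (1 + \<rho> p))"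
proof -
  let ?n = "length bs"
  define g where "g p = sqrt c * (gs ! k \<bullet> bs ! p)" for p
  define a where "a p = 1 + \<rho> p + (if p = i then c * \<alpha>\<^sup>2 else 0)" for p
  define s where "s = (\<Sum>p<?n. c * (gs ! k \<bullet> bs ! p)\<^sup>2 / (1 + \<rho> p))"
  have \<rho>: "0 \<le> \<rho> p" if "p < ?n" for p
  proof -
    have "\<rho> p = c * (\<Sum>k<length gs. (gs ! k \<bullet> bs ! p) * (gs ! k \<bullet> bs ! p))"
      using diag[OF that that] by simp
    also have "\<dots> \<ge> 0" using c by (simp add: sum_nonneg)
    finally show ?thesis .
  qed
  have q: "0 \<le> q" using c \<rho>[OF i] by (simp add: q_def)
  have a_pos: "0 < a p" if "p < ?n" for p
    using \<rho>[OF that] c by (auto simp: a_def add_pos_nonneg)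
  have det_old: "det_id_plus (frame_operator c gs) = (\<Prod>p<?n. 1 + \<rho> p)"
  proof -
    have "det_id_plus (frame_operator c gs)
        = Determinant.det (Matrix.mat ?n ?n (\<lambda>(p, q). (if p = q then 1 + \<rho> p else 0) - (\<lambda>_. 0) p * (\<lambda>_. 0) q))"
      by (subst det_id_plus_frame_operator[OF bs gs], intro arg_cong[of _ _ Determinant.det] cong_mat)
        (auto simp: diag)
    also have "\<dots> = (\<Prod>p<?n. 1 + \<rho> p)"
      by (subst det_diagonal_minus_rank_one) (use \<rho> in \<open>force simp: add_nonneg_eq_0_iff\<close>)+
    finally show ?thesis .
  qed
  have det_new: "det_id_plus (frame_operator c (gs[k := \<alpha> *\<^sub>R bs ! i]))
      = (\<Prod>p<?n. a p) * (1 - (\<Sum>p<?n. g p * g p / a p))"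
  proof -
    have set: "set (gs[k := \<alpha> *\<^sub>R bs ! i]) \<subseteq> span (set bs)"
    proof -
      have "\<alpha> *\<^sub>R bs ! i \<in> span (set bs)" using i by (intro span_scale span_base) simp
      then show ?thesis using gs set_update_subset_insert[of gs k "\<alpha> *\<^sub>R bs ! i"] by blast
    qed
    have entry: "(if p = q then 1 else 0) + c * (\<Sum>l<length (gs[k := \<alpha> *\<^sub>R bs ! i]).
          (gs[k := \<alpha> *\<^sub>R bs ! i] ! l \<bullet> bs ! p) * (gs[k := \<alpha> *\<^sub>R bs ! i] ! l \<bullet> bs ! q))
        = (if p = q then a p else 0) - g p * g q" if pq: "p < ?n" "q < ?n" for p q
    proof -
      let ?f = "\<lambda>l. (gs ! l \<bullet> bs ! p) * (gs ! l \<bullet> bs ! q)"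
      let ?f' = "\<lambda>l. (gs[k := \<alpha> *\<^sub>R bs ! i] ! l \<bullet> bs ! p) * (gs[k := \<alpha> *\<^sub>R bs ! i] ! l \<bullet> bs ! q)"
      have "sum ?f' {..<length gs} = ?f' k + sum ?f' ({..<length gs} - {k})"
        using k by (intro sum.remove) auto
      also have "sum ?f' ({..<length gs} - {k}) = sum ?f ({..<length gs} - {k})"
        by (intro sum.cong) auto
      also have "\<dots> = sum ?f {..<length gs} - ?f k"
        using k by (subst (2) sum.remove[of _ k]) auto
      finally have "c * sum ?f' {..<length gs}
          = c * ?f' k + (c * sum ?f {..<length gs} - c * ?f k)"
        by (simp only: distrib_left right_diff_distrib)
      moreover have "c * ?f' k = (if p = i \<and> q = i then c * \<alpha>\<^sup>2 else 0)"
        using k i pq bs by (simp add: orthonormal_list_def power2_eq_square)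
      moreover have "c * ?f k = g p * g q" using c by (simp add: g_def)
      moreover note diag[OF pq]
      ultimately show ?thesis by (simp add: a_def)
    qed
    have "det_id_plus (frame_operator c (gs[k := \<alpha> *\<^sub>R bs ! i]))
        = Determinant.det (Matrix.mat ?n ?n (\<lambda>(p, q). (if p = q then a p else 0) - g p * g q))"
      by (subst det_id_plus_frame_operator[OF bs set], intro arg_cong[of _ _ Determinant.det] cong_mat)
        (simp_all add: entry del: length_list_update)
    also have "\<dots> = (\<Prod>p<?n. a p) * (1 - (\<Sum>p<?n. g p * g p / a p))"
      by (rule det_diagonal_minus_rank_one) (use a_pos in force)
    finally show ?thesis .
  qed
  have prod_a: "(\<Prod>p<?n. a p) = (1 + q) * (\<Prod>p<?n. 1 + \<rho> p)"
  proof -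
    have "q * (1 + \<rho> i) = c * \<alpha>\<^sup>2" using \<rho>[OF i] by (simp add: q_def)
    then have "a i = (1 + q) * (1 + \<rho> i)" by (simp add: a_def distrib_right)
    then have "a p = (if p = i then 1 + q else 1) * (1 + \<rho> p)" for p by (simp add: a_def)
    then have "(\<Prod>p<?n. a p) = (\<Prod>p<?n. (if p = i then 1 + q else 1) * (1 + \<rho> p))"
      by (intro prod.cong refl)
    then show ?thesis using i by (simp add: prod.distrib)
  qed
  have prod_pos: "0 < (\<Prod>p<?n. 1 + \<rho> p)" using \<rho> by (intro prod_pos) (auto simp: add_pos_nonneg)
  have s_le: "(\<Sum>p<?n. g p * g p / a p) \<le> s"
    unfolding s_def
  proof (rule sum_mono)
    fix p assume "p \<in> {..<?n}"
    then have p: "p < ?n" by simp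
    have "g p * g p = c * (gs ! k \<bullet> bs ! p)\<^sup>2" using c by (simp add: g_def power2_eq_square)
    moreover have "c * (gs ! k \<bullet> bs ! p)\<^sup>2 / a p \<le> c * (gs ! k \<bullet> bs ! p)\<^sup>2 / (1 + \<rho> p)"
      using c \<rho>[OF p] a_pos[OF p] by (intro divide_left_mono mult_pos_pos) (auto simp: a_def)
    ultimately show "g p * g p / a p \<le> c * (gs ! k \<bullet> bs ! p)\<^sup>2 / (1 + \<rho> p)" by simp
  qed
  have "q \<le> (1 + q) * s"
  proof (cases "s < 1")
    case True
    let ?t = "1 - (\<Sum>p<?n. g p * g p / a p)"
    have t: "1 - s \<le> ?t" "0 < ?t" using s_le True by auto
    have "0 < (\<Prod>p<?n. a p) * ?t" using prod_a prod_pos q t by (simp add: add_pos_nonneg)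
    then have "(\<Prod>p<?n. a p) * ?t \<le> (\<Prod>p<?n. 1 + \<rho> p)"
      using opt prod_pos unfolding det_old det_new by simp
    then have "((1 + q) * ?t) * (\<Prod>p<?n. 1 + \<rho> p) \<le> 1 * (\<Prod>p<?n. 1 + \<rho> p)"
      unfolding prod_a by (simp add: mult_ac)
    then have "(1 + q) * ?t \<le> 1" using prod_pos by (rule mult_right_le_imp_le)
    moreover have "(1 + q) * (1 - s) \<le> (1 + q) * ?t" using q t by (intro mult_left_mono) auto
    ultimately show ?thesis by (simp add: algebra_simps)
  next
    case False
    then have "(1 + q) * 1 \<le> (1 + q) * s" using q by (intro mult_left_mono) auto
    then show ?thesis by simp
  qed
  then show ?thesis by (simp add: s_def)
qed

section \<open>The design objective as a frame determinant\<close>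

text \<open>
  The adjoint of \<open>F \<circ> \<Gamma>\<^sup>1\<^sup>/\<^sup>2\<close>. It maps orthogonal eigenvectors of \<open>F \<Gamma> F\<^sup>*\<close> to orthogonal vectors,
  which transports the common eigenbasis from the observation space to the parameter space.
\<close>
definition whitened_adjoint ::
  "('p::real_inner \<Rightarrow> 'o::real_inner) \<Rightarrow> ('p \<Rightarrow> 'p) \<Rightarrow> 'o \<Rightarrow> 'p" where
  "whitened_adjoint F \<Gamma> u = operator_sqrt \<Gamma> (adjoint F u)"

lemma linear_adjoint:
  fixes F :: "'p::{real_inner, complete_space} \<Rightarrow> 'o::real_inner"
  assumes F: "bounded_linear F"
  shows "linear (adjoint F)"
proof (rule linearI)
  show "adjoint F (u + w) = adjoint F u + adjoint F w" for u w
    by (subst vector_eq_ldot[symmetric]) (simp add: inner_add_right flip: adjoint_inner[OF F])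
  show "adjoint F (r *\<^sub>R u) = r *\<^sub>R adjoint F u" for r u
    by (subst vector_eq_ldot[symmetric]) (simp flip: adjoint_inner[OF F])
qed

context
  fixes F :: "'p::{real_inner, complete_space} \<Rightarrow> 'o::real_inner" and \<Gamma> :: "'p \<Rightarrow> 'p"
  assumes F: "bounded_linear F" and \<Gamma>: "positive_operator \<Gamma>"
begin

lemma linear_whitened_adjoint: "linear (whitened_adjoint F \<Gamma>)"
proof -
  have "linear (operator_sqrt \<Gamma>)"
    using operator_sqrt(1)[OF \<Gamma>] by (simp add: positive_operator_def bounded_linear.linear)
  from linear_compose[OF linear_adjoint[OF F] this] show ?thesis
    by (simp add: whitened_adjoint_def[abs_def] o_def)
qed

lemma whitened_adjoint_inner: "whitened_adjoint F \<Gamma> u \<bullet> x = u \<bullet> F (operator_sqrt \<Gamma> x)"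
proof -
  have "operator_sqrt \<Gamma> (adjoint F u) \<bullet> x = adjoint F u \<bullet> operator_sqrt \<Gamma> x"
    using operator_sqrt(1)[OF \<Gamma>] unfolding positive_operator_def by blast
  then show ?thesis
    unfolding whitened_adjoint_def by (metis adjoint_inner[OF F] inner_commute)
qed

lemma whitened_adjoint_inner_whitened_adjoint:
  "whitened_adjoint F \<Gamma> u \<bullet> whitened_adjoint F \<Gamma> w = u \<bullet> pushforward_cov F \<Gamma> w"
  by (simp add: whitened_adjoint_inner)
    (simp add: whitened_adjoint_def operator_sqrt(2)[OF \<Gamma>] pushforward_cov_def)

lemma linear_pushforward_cov: "linear (pushforward_cov F \<Gamma>)"
proof -
  have "linear \<Gamma>" using \<Gamma> by (simp add: positive_operator_def bounded_linear.linear)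
  with linear_adjoint[OF F] bounded_linear.linear[OF F] show ?thesis
    unfolding pushforward_cov_def by (intro linear_compose)
qed

lemma inner_pushforward_cov: "u \<bullet> pushforward_cov F \<Gamma> w = \<Gamma> (adjoint F w) \<bullet> adjoint F u"
  by (simp add: pushforward_cov_def inner_commute[of u] adjoint_inner[OF F])

lemma design_objective_eq:
  "design_objective F \<Gamma> \<sigma> obs
    = 1/2 * ln (det_id_plus (frame_operator (1 / \<sigma>\<^sup>2) (map (whitened_adjoint F \<Gamma>) obs)))"
proof -
  have "operator_sqrt \<Gamma> (adjoint F (measure_adj obs (measure_op obs (F (operator_sqrt \<Gamma> x)))))
      = (\<Sum>k<length obs. (whitened_adjoint F \<Gamma> (obs ! k) \<bullet> x) *\<^sub>R whitened_adjoint F \<Gamma> (obs ! k))" for x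
    unfolding whitened_adjoint_def[symmetric] measure_adj_def
    by (simp add: linear_sum[OF linear_whitened_adjoint] linear_cmul[OF linear_whitened_adjoint]
        measure_op_def whitened_adjoint_inner)
  then show ?thesis
    by (simp add: design_objective_def frame_operator_def[abs_def])
qed

end

section \<open>Posterior variance along a common eigenvector\<close>

lemma inner_measure_adj_measure_op:
  "w \<bullet> measure_adj obs (measure_op obs u) = (\<Sum>k<length obs. (obs ! k \<bullet> u) * (obs ! k \<bullet> w))"
  by (simp add: measure_adj_def measure_op_def inner_sum_right inner_commute)

lemma measure_adj_in_span: "measure_adj obs y \<in> span (set obs)"
  unfolding measure_adj_def by (intro span_sum span_scale span_base) simp

lemma linear_measure_adj_measure_op: "linear (\<lambda>u. measure_adj obs (measure_op obs u))"
  by (rule linearI)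
    (simp_all add: measure_adj_def measure_op_def inner_add_right scaleR_add_left sum.distrib
      flip: scaleR_scaleR scaleR_sum_right)

text \<open>
  The precision operator is injective on the range of \<open>F \<Gamma> F\<^sup>*\<close>: if it annihilates \<open>F \<Gamma> F\<^sup>* z\<close>,
  then pairing with this vector gives a sum of two nonnegative terms, one of which is
  \<open>\<Gamma> (F\<^sup>* z) \<bullet> F\<^sup>* z\<close>. On a common eigenvector the inversion is then scalar.
\<close>
lemma posterior_pushforward_cov_eigenvalue:
  fixes F :: "'p::{real_inner, complete_space} \<Rightarrow> 'o::real_inner"
  assumes F: "bounded_linear F" and \<Gamma>: "positive_definite_operator \<Gamma>"
    and inj: "inj (pushforward_cov F \<Gamma>)"
    and lam: "0 < lam" "pushforward_cov F \<Gamma> v = lam *\<^sub>R v"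
    and eta: "0 \<le> eta" "measure_adj obs (measure_op obs v) = eta *\<^sub>R v"
  shows "posterior_pushforward_cov F \<Gamma> \<sigma> obs v = (1 / (1 / lam + eta / \<sigma>\<^sup>2)) *\<^sub>R v"
proof -
  let ?T = "pushforward_cov F \<Gamma>" and ?N = "\<lambda>u. measure_adj obs (measure_op obs u)"
  let ?\<Phi> = "\<lambda>u. the_inv ?T u + (1 / \<sigma>\<^sup>2) *\<^sub>R ?N u"
  have \<Gamma>': "positive_operator \<Gamma>" using \<Gamma> by (simp add: positive_definite_operator_def)
  note linT = linear_pushforward_cov[OF F \<Gamma>'] and linN = linear_measure_adj_measure_op[of obs]
  have inv: "the_inv ?T (?T x) = x" for x by (rule the_inv_f_f[OF inj])
  have inj_\<Phi>: "inj_on ?\<Phi> (range ?T)"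
  proof (rule inj_onI)
    fix u w assume uw: "u \<in> range ?T" "w \<in> range ?T" "?\<Phi> u = ?\<Phi> w"
    then obtain x y where x: "u = ?T x" and y: "w = ?T y" by auto
    define z where "z = x - y"
    have Tz: "?T z = u - w" by (simp add: z_def x y linear_diff[OF linT])
    have "z + (1 / \<sigma>\<^sup>2) *\<^sub>R ?N (?T z) = 0"
      using uw(3) unfolding Tz linear_diff[OF linN] by (simp add: x y inv z_def algebra_simps)
    then have "0 = (z + (1 / \<sigma>\<^sup>2) *\<^sub>R ?N (?T z)) \<bullet> ?T z" by simp
    also have "\<dots> = z \<bullet> ?T z + (1 / \<sigma>\<^sup>2) * (?T z \<bullet> ?N (?T z))"
      by (simp only: inner_add_left inner_scaleR_left inner_commute[of "?N (?T z)" "?T z"])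
    finally have sum0: "z \<bullet> ?T z + (1 / \<sigma>\<^sup>2) * (?T z \<bullet> ?N (?T z)) = 0" by simp
    have "0 \<le> ?T z \<bullet> ?N (?T z)"
      unfolding inner_measure_adj_measure_op by (intro sum_nonneg) simp
    then have "0 \<le> (1 / \<sigma>\<^sup>2) * (?T z \<bullet> ?N (?T z))" by simp
    with sum0 have "\<Gamma> (adjoint F z) \<bullet> adjoint F z \<le> 0"
      unfolding inner_pushforward_cov[OF F \<Gamma>', of z z, symmetric] by linarith
    then have "adjoint F z = 0"
      using \<Gamma> unfolding positive_definite_operator_def by (meson not_less)
    moreover have "\<Gamma> 0 = 0" "F 0 = 0"
      using \<Gamma>' F by (auto simp: positive_operator_def linear_0 bounded_linear.linear)
    ultimately have "?T z = 0" by (simp add: pushforward_cov_def)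
    then show "u = w" using Tz by simp
  qed
  define d where "d = 1 / lam + eta / \<sigma>\<^sup>2"
  have d: "0 < d" using lam(1) eta(1) by (simp add: d_def add_pos_nonneg)
  have preimage: "(1 / d) *\<^sub>R v = ?T ((1 / (d * lam)) *\<^sub>R v)"
    using lam by (simp add: linear_cmul[OF linT])
  have "?\<Phi> ((1 / d) *\<^sub>R v) = (1 / (d * lam)) *\<^sub>R v + (1 / \<sigma>\<^sup>2) *\<^sub>R ((1 / d) *\<^sub>R (eta *\<^sub>R v))"
    by (subst preimage) (simp only: inv linear_cmul[OF linN] eta(2))
  also have "\<dots> = (1 / (d * lam) + eta / (\<sigma>\<^sup>2 * d)) *\<^sub>R v"
    by (simp add: scaleR_add_left)
  also have "1 / (d * lam) + eta / (\<sigma>\<^sup>2 * d) = (1 / d) * (1 / lam + eta / \<sigma>\<^sup>2)"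
    by (simp add: distrib_left mult.commute)
  also have "\<dots> = 1" using d by (simp flip: d_def)
  finally have "?\<Phi> ((1 / d) *\<^sub>R v) = v" by simp
  moreover note inj_\<Phi>
  moreover have "(1 / d) *\<^sub>R v \<in> range ?T" by (subst preimage) simp
  ultimately have "the_inv_into (range ?T) ?\<Phi> v = (1 / d) *\<^sub>R v"
    by (intro the_inv_into_f_eq)
  then show ?thesis by (simp add: posterior_pushforward_cov_def d_def)
qed

section \<open>Optimal designs\<close>

text \<open>
  Here \<open>q\<close> is the eigenvalue of the posterior pushforward covariance at \<open>e i\<close>, divided by \<open>\<sigma>\<^sup>2\<close>.
  Optimality against replacing the \<open>k\<close>-th measurement by \<open>e i\<close> gives \<open>q \<le> (1 + q) s\<^sub>k\<close> for a
  leverage score \<open>s\<^sub>k\<close>. Summed over \<open>k\<close>, the scores give the sum over \<open>j\<close> of \<open>\<rho> j / (1 + \<rho> j)\<close>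
  with \<open>\<rho> j = lam j * \<eta> j / \<sigma>\<^sup>2\<close>. The first \<open>n\<close> terms are at most \<open>1\<close>. The others are at most
  \<open>lam n * \<eta> j / \<sigma>\<^sup>2\<close>, and the \<open>\<eta> j\<close> add up to at most \<open>m\<close> because the measurements are unit
  vectors.
\<close>
lemma optimal_exchange_bound:
  fixes F :: "'p::{real_inner, complete_space} \<Rightarrow> 'o::real_inner"
    and e :: "nat \<Rightarrow> 'o"
    and i n :: nat
  assumes F: "bounded_linear F" and \<sigma>: "0 < \<sigma>\<^sup>2" and \<Gamma>: "positive_operator \<Gamma>"
    and opt: "d_optimal F \<Gamma> \<sigma> m obs"
    and T: "is_eigenbasis e (pushforward_cov F \<Gamma>) lam" and lam: "decseq lam" "\<And>j. 0 < lam j"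
    and N: "is_eigenbasis e (measure_adj obs \<circ> measure_op obs) \<eta>"
  defines "q \<equiv> lam i / \<sigma>\<^sup>2 / (1 + lam i * \<eta> i / \<sigma>\<^sup>2)"
  shows "0 \<le> \<eta> i" and "real m * q \<le> (1 + q) * (real n + lam n / \<sigma>\<^sup>2 * real m)"
proof -
  define c where "c = 1 / \<sigma>\<^sup>2"
  have c: "0 < c" using \<sigma> by (simp add: c_def)
  let ?L = "whitened_adjoint F \<Gamma>"
  note linL = linear_whitened_adjoint[OF F \<Gamma>]
  have basis: "orthonormal_basis e" using T by (simp add: is_eigenbasis_def)
  then have on: "e i \<bullet> e j = (if i = j then 1 else 0)" for i j
    by (simp add: orthonormal_basis_def)
  have eta: "measure_adj obs (measure_op obs (e j)) = \<eta> j *\<^sub>R e j" for j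
    using N by (simp add: is_eigenbasis_def)
  have design: "length obs = m" "\<And>k. k < m \<Longrightarrow> norm (obs ! k) = 1"
    using opt by (auto simp: d_optimal_def is_arg_max_def is_design_def)
  have gram: "(\<Sum>k<m. (obs ! k \<bullet> e j) * (obs ! k \<bullet> e l)) = (if j = l then \<eta> j else 0)" for j l
    using inner_measure_adj_measure_op[of "e l" obs "e j"]
    by (cases "j = l") (simp_all add: eta design on)
  have eta_sum: "\<eta> j = (\<Sum>k<m. (obs ! k \<bullet> e j)\<^sup>2)" for j
    using gram[of j j] by (simp add: power2_eq_square)
  then have eta_nonneg: "0 \<le> \<eta> j" for j by (simp add: sum_nonneg)
  then show "0 \<le> \<eta> i" .
  have L_eigen: "?L u \<bullet> ?L (e j) = lam j * (u \<bullet> e j)" for u j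
    using T by (simp add: whitened_adjoint_inner_whitened_adjoint[OF F \<Gamma>] is_eigenbasis_def)

  \<comment> \<open>the directions seen by the design, and the direction used in the exchange\<close>
  define J where "J = insert i {j. \<eta> j \<noteq> 0}"
  have "finite {j. \<eta> j \<noteq> 0}"
  proof -
    have e_inj: "inj e" by (rule injI) (metis on zero_neq_one)
    have "e j \<in> span (set obs)" if "\<eta> j \<noteq> 0" for j
    proof -
      have "e j = (1 / \<eta> j) *\<^sub>R measure_adj obs (measure_op obs (e j))" using that by (simp add: eta)
      also have "\<dots> \<in> span (set obs)" by (intro span_scale measure_adj_in_span)
      finally show ?thesis .
    qed
    moreover have "independent (e ` {j. \<eta> j \<noteq> 0})"
    proof (rule pairwise_orthogonal_independent)
      show "pairwise real_inner_class.orthogonal (e ` {j. \<eta> j \<noteq> 0})"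
        by (auto simp: pairwise_def real_inner_class.orthogonal_def on)
      show "0 \<notin> e ` {j. \<eta> j \<noteq> 0}" by (metis imageE inner_zero_left on zero_neq_one)
    qed
    ultimately have "finite (e ` {j. \<eta> j \<noteq> 0})"
      using independent_span_bound[of "set obs" "e ` {j. \<eta> j \<noteq> 0}"] by auto
    then show ?thesis using e_inj by (simp add: finite_image_iff inj_on_subset)
  qed
  then have J: "finite J" "i \<in> J" by (simp_all add: J_def)
  have expand: "obs ! k = (\<Sum>j\<in>J. (obs ! k \<bullet> e j) *\<^sub>R e j)" if "k < m" for k
  proof (rule orthonormal_basis_finite_expansion[OF basis J(1)])
    fix j assume "j \<notin> J"
    then have "(\<Sum>k<m. (obs ! k \<bullet> e j)\<^sup>2) = 0" using eta_sum[of j] by (simp add: J_def)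
    with that show "obs ! k \<bullet> e j = 0" by (simp add: sum_nonneg_eq_0_iff)
  qed

  define js where "js = sorted_list_of_set J"
  have js: "set js = J" "distinct js" using J by (simp_all add: js_def)
  define bs where "bs = map (\<lambda>j. (1 / sqrt (lam j)) *\<^sub>R ?L (e j)) js"
  have len: "length bs = length js" by (simp add: bs_def)
  have bs_nth: "bs ! p = (1 / sqrt (lam (js ! p))) *\<^sub>R ?L (e (js ! p))" if "p < length js" for p
    using that by (simp add: bs_def)
  have L_bs: "?L u \<bullet> bs ! p = sqrt (lam (js ! p)) * (u \<bullet> e (js ! p))" if "p < length js" for u p
  proof -
    have "?L u \<bullet> bs ! p = lam (js ! p) / sqrt (lam (js ! p)) * (u \<bullet> e (js ! p))"
      by (simp add: bs_nth[OF that] L_eigen)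
    then show ?thesis by (simp add: real_div_sqrt less_imp_le lam)
  qed
  have sqrt_nz: "sqrt (lam j) \<noteq> 0" for j using lam(2)[of j] by simp
  have bs: "orthonormal_list bs"
    unfolding orthonormal_list_def len
  proof (intro allI impI)
    fix p r assume pr: "p < length js" "r < length js"
    have "bs ! p \<bullet> bs ! r = (1 / sqrt (lam (js ! p))) * (?L (e (js ! p)) \<bullet> bs ! r)"
      by (subst bs_nth[OF pr(1)]) simp
    also have "\<dots> = (if p = r then 1 else 0)"
      using pr js(2) sqrt_nz by (simp add: L_bs on nth_eq_iff_index_eq)
    finally show "bs ! p \<bullet> bs ! r = (if p = r then 1 else 0)" .
  qed
  have Le_span: "?L (e j) \<in> span (set bs)" if "j \<in> J" for j
  proof -
    have "(1 / sqrt (lam j)) *\<^sub>R ?L (e j) \<in> set bs" using that by (auto simp: bs_def js(1))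
    then have "sqrt (lam j) *\<^sub>R ((1 / sqrt (lam j)) *\<^sub>R ?L (e j)) \<in> span (set bs)"
      by (intro span_scale span_base)
    then show ?thesis using sqrt_nz[of j] by simp
  qed
  define gs where "gs = map ?L obs"
  have gs: "set gs \<subseteq> span (set bs)"
  proof
    fix g assume "g \<in> set gs"
    then obtain k where k: "k < m" "g = ?L (obs ! k)"
      using design(1) by (auto simp: gs_def in_set_conv_nth)
    have "g = (\<Sum>j\<in>J. (obs ! k \<bullet> e j) *\<^sub>R ?L (e j))"
      unfolding k(2) by (subst expand[OF k(1)])
        (simp add: linear_sum[OF linL] linear_cmul[OF linL])
    then show "g \<in> span (set bs)" by (simp add: span_sum span_scale Le_span)
  qed
  have gs_len: "length gs = m" using design(1) by (simp add: gs_def)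
  have gs_bs: "gs ! k \<bullet> bs ! p = sqrt (lam (js ! p)) * (obs ! k \<bullet> e (js ! p))"
    if "k < m" "p < length js" for k p
    using that design(1) by (simp add: gs_def L_bs)
  define \<rho> where "\<rho> j = c * lam j * \<eta> j" for j
  have \<rho>: "0 \<le> \<rho> j" for j using c lam(2)[of j] eta_nonneg[of j] by (simp add: \<rho>_def)
  have diag: "c * (\<Sum>k<length gs. (gs ! k \<bullet> bs ! p) * (gs ! k \<bullet> bs ! r)) = (if p = r then \<rho> (js ! p) else 0)"
    if "p < length bs" "r < length bs" for p r
  proof -
    have pr: "p < length js" "r < length js" using that by (simp_all add: len)
    have "(\<Sum>k<length gs. (gs ! k \<bullet> bs ! p) * (gs ! k \<bullet> bs ! r))
        = (\<Sum>k<m. sqrt (lam (js ! p)) * sqrt (lam (js ! r)) * ((obs ! k \<bullet> e (js ! p)) * (obs ! k \<bullet> e (js ! r))))"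
      using pr by (intro sum.cong) (auto simp: gs_bs gs_len mult_ac)
    also have "\<dots> = sqrt (lam (js ! p)) * sqrt (lam (js ! r)) * (if js ! p = js ! r then \<eta> (js ! p) else 0)"
      by (simp only: sum_distrib_left[symmetric] gram)
    finally show ?thesis
      using pr js(2) lam(2)[of "js ! r"] by (simp add: nth_eq_iff_index_eq \<rho>_def)
  qed
  obtain p where p: "p < length js" "js ! p = i" using J(2) js(1) by (metis in_set_conv_nth)
  have q: "q = c * (sqrt (lam i))\<^sup>2 / (1 + \<rho> (js ! p))"
    using p(2) lam(2)[of i] by (simp add: q_def c_def \<rho>_def mult.commute)
  have q_nonneg: "0 \<le> q" unfolding q using c \<rho>[of "js ! p"] by simp
  have exchange: "q \<le> (1 + q) * (\<Sum>r<length bs. c * (gs ! k \<bullet> bs ! r)\<^sup>2 / (1 + \<rho> (js ! r)))"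
    if k: "k < m" for k
    unfolding q
  proof (rule frame_exchange[OF c bs gs diag])
    show "k < length gs" using k by (simp add: gs_len)
    show "p < length bs" using p len by simp
    have "is_design m (obs[k := e i])"
    proof -
      have "norm (e i) = 1" using on[of i i] by (simp add: norm_eq_1)
      moreover have "norm v = 1" if "v \<in> set obs" for v
        using that design by (auto simp: in_set_conv_nth)
      ultimately show ?thesis
        using design(1) set_update_subset_insert[of obs k "e i"] by (auto simp: is_design_def)
    qed
    then have "design_objective F \<Gamma> \<sigma> (obs[k := e i]) \<le> design_objective F \<Gamma> \<sigma> obs"
      using opt by (auto simp: d_optimal_def is_arg_max_def not_less)
    moreover have "?L (e i) = sqrt (lam i) *\<^sub>R bs ! p" using p sqrt_nz[of i] by (simp add: bs_nth)
    ultimately show "ln (det_id_plus (frame_operator c (gs[k := sqrt (lam i) *\<^sub>R bs ! p])))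
        \<le> ln (det_id_plus (frame_operator c gs))"
      by (simp add: design_objective_eq[OF F \<Gamma>] c_def gs_def map_update)
  qed
  have leverage: "(\<Sum>k<m. \<Sum>r<length bs. c * (gs ! k \<bullet> bs ! r)\<^sup>2 / (1 + \<rho> (js ! r)))
      = (\<Sum>j\<in>J. \<rho> j / (1 + \<rho> j))"
  proof -
    have "(\<Sum>k<m. \<Sum>r<length bs. c * (gs ! k \<bullet> bs ! r)\<^sup>2 / (1 + \<rho> (js ! r)))
        = (\<Sum>r<length bs. \<Sum>k<m. c * (gs ! k \<bullet> bs ! r)\<^sup>2 / (1 + \<rho> (js ! r)))"
      by (rule sum.swap)
    also have "\<dots> = (\<Sum>r<length bs. \<rho> (js ! r) / (1 + \<rho> (js ! r)))"
    proof (rule sum.cong[OF refl])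
      fix r assume "r \<in> {..<length bs}"
      then have r: "r < length bs" by simp
      show "(\<Sum>k<m. c * (gs ! k \<bullet> bs ! r)\<^sup>2 / (1 + \<rho> (js ! r))) = \<rho> (js ! r) / (1 + \<rho> (js ! r))"
      proof -
        have "(\<Sum>k<m. c * (gs ! k \<bullet> bs ! r)\<^sup>2 / (1 + \<rho> (js ! r)))
            = (c * (\<Sum>k<m. (gs ! k \<bullet> bs ! r) * (gs ! k \<bullet> bs ! r))) / (1 + \<rho> (js ! r))"
          by (simp only: sum_divide_distrib sum_distrib_left power2_eq_square)
        then show ?thesis using diag[OF r r] by (simp add: gs_len)
      qed
    qed
    also have "\<dots> = (\<Sum>j\<in>J. \<rho> j / (1 + \<rho> j))"
      unfolding len using js
      by (intro sum.reindex_bij_betw[of "(!) js" _ J "\<lambda>j. \<rho> j / (1 + \<rho> j)"] bij_betw_nth) auto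
    finally show ?thesis .
  qed
  have "(\<Sum>j\<in>J. \<rho> j / (1 + \<rho> j)) \<le> (\<Sum>j\<in>J. (if j < n then 1 else 0) + c * lam n * \<eta> j)"
  proof (rule sum_mono)
    fix j
    have nonneg: "0 \<le> c * lam n * \<eta> j" using c lam(2)[of n] eta_nonneg[of j] by simp
    show "\<rho> j / (1 + \<rho> j) \<le> (if j < n then 1 else 0) + c * lam n * \<eta> j"
    proof (cases "j < n")
      case True
      have "\<rho> j / (1 + \<rho> j) \<le> 1" using \<rho>[of j] by simp
      with True nonneg show ?thesis by simp
    next
      case False
      have "\<rho> j / (1 + \<rho> j) \<le> \<rho> j / 1" using \<rho>[of j] by (intro divide_left_mono) auto
      also have "\<dots> \<le> c * lam n * \<eta> j"
        using False c eta_nonneg[of j] decseqD[OF lam(1), of n j]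
        by (auto simp: \<rho>_def intro!: mult_right_mono mult_left_mono)
      finally show ?thesis using False by simp
    qed
  qed
  also have "\<dots> = real (card (J \<inter> {..<n})) + c * lam n * (\<Sum>j\<in>J. \<eta> j)"
  proof -
    have "J \<inter> {..<n} = {j \<in> J. j < n}" by auto
    then show ?thesis using J(1) by (simp add: sum.distrib sum_distrib_left flip: sum.inter_filter)
  qed
  also have "\<dots> \<le> real n + c * lam n * real m"
  proof (intro add_mono mult_left_mono)
    have "card (J \<inter> {..<n}) \<le> card {..<n}" by (intro card_mono) auto
    then show "real (card (J \<inter> {..<n})) \<le> real n" by simp
    have "(\<Sum>j\<in>J. \<eta> j) = (\<Sum>k<m. \<Sum>j\<in>J. (obs ! k \<bullet> e j)\<^sup>2)"
      unfolding eta_sum by (rule sum.swap)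
    also have "\<dots> \<le> (\<Sum>k<m. (norm (obs ! k))\<^sup>2)"
      by (intro sum_mono Bessel_inequality on J)
    also have "\<dots> = real m" using design(2) by simp
    finally show "(\<Sum>j\<in>J. \<eta> j) \<le> real m" .
    show "0 \<le> c * lam n" using c lam(2)[of n] by simp
  qed
  finally have total: "(\<Sum>j\<in>J. \<rho> j / (1 + \<rho> j)) \<le> real n + c * lam n * real m" .
  have "real m * q = (\<Sum>k<m. q)" by simp
  also have "\<dots> \<le> (\<Sum>k<m. (1 + q) * (\<Sum>r<length bs. c * (gs ! k \<bullet> bs ! r)\<^sup>2 / (1 + \<rho> (js ! r))))"
    by (intro sum_mono exchange) simp
  also have "\<dots> = (1 + q) * (\<Sum>j\<in>J. \<rho> j / (1 + \<rho> j))"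
    by (simp only: sum_distrib_left[symmetric] leverage)
  also have "\<dots> \<le> (1 + q) * (real n + c * lam n * real m)"
    using total q_nonneg by (intro mult_left_mono) auto
  finally show "real m * q \<le> (1 + q) * (real n + lam n / \<sigma>\<^sup>2 * real m)"
    by (simp add: c_def)
qed

theorem mainTheorem5:
  fixes F :: "'p::{real_inner, polish_space} \<Rightarrow> 'o::{real_inner, polish_space}"
    and \<Gamma> :: "'p \<Rightarrow> 'p"
    and prior :: "'p measure"
    and prior_mean :: 'p
    and \<sigma> :: real
    and D :: "nat \<Rightarrow> 'o list"
    and lam :: "nat \<Rightarrow> real"
    and e :: "nat \<Rightarrow> nat \<Rightarrow> 'o"
    and \<theta> :: "nat \<Rightarrow> nat \<Rightarrow> real"
  assumes "infinite_dimensional TYPE('o)"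
    and "bounded_linear F"
    and "0 < \<sigma>\<^sup>2"
    and "gaussian_measure prior prior_mean \<Gamma>"
    and "positive_definite_operator \<Gamma>"
    and "inj (pushforward_cov F \<Gamma>)"
    and "\<And>m. m \<ge> 1 \<Longrightarrow> d_optimal F \<Gamma> \<sigma> m (D m)"
    and "decseq lam"
    and "\<And>m. m \<ge> 1 \<Longrightarrow> is_eigenbasis (e m) (pushforward_cov F \<Gamma>) lam"
    and "\<And>m. m \<ge> 1 \<Longrightarrow> \<exists>\<eta>. is_eigenbasis (e m) (measure_adj (D m) \<circ> measure_op (D m)) \<eta>"
    and "\<And>m. m \<ge> 1 \<Longrightarrow> is_eigenbasis (e m) (posterior_pushforward_cov F \<Gamma> \<sigma> (D m)) (\<theta> m)"
  shows "\<forall>i. (\<lambda>m. \<theta> m i) \<longlonglongrightarrow> 0"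
proof
  fix i
  note F = assms(2) and \<sigma> = assms(3)
  have \<Gamma>: "positive_operator \<Gamma>" using assms(5) by (simp add: positive_definite_operator_def)
  define b where "b = e 1"
  have T1: "orthonormal_basis b" "pushforward_cov F \<Gamma> (b j) = lam j *\<^sub>R b j" for j
    using assms(9)[of 1] unfolding b_def by (auto simp: is_eigenbasis_def)
  have on1: "b j \<bullet> b k = (if j = k then 1 else 0)" for j k
    using T1(1) by (simp add: orthonormal_basis_def)
  have lam_eq: "lam j = \<Gamma> (adjoint F (b j)) \<bullet> adjoint F (b j)" for j
    unfolding inner_pushforward_cov[OF F \<Gamma>, symmetric] by (simp add: T1(2) on1)
  have lam_pos: "0 < lam j" for j
  proof -
    have "0 \<le> lam j" unfolding lam_eq by (rule positive_operator_nonneg[OF \<Gamma>])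
    moreover have "lam j \<noteq> 0"
    proof
      assume "lam j = 0"
      then have "pushforward_cov F \<Gamma> (b j) = pushforward_cov F \<Gamma> 0"
        using T1(2)[of j] linear_0[OF linear_pushforward_cov[OF F \<Gamma>]] by simp
      then have "b j = 0" using assms(6) by (simp add: inj_eq)
      then show False using on1[of j j] by simp
    qed
    ultimately show ?thesis by simp
  qed
  have "(\<lambda>j. x \<bullet> adjoint F (b j)) \<longlonglongrightarrow> 0" for x
    using orthonormal_weakly_null[of b "F x", OF on1] by (simp add: adjoint_inner[OF F])
  from gaussian_variance_tendsto_0[OF assms(4) this] have lam_lim: "lam \<longlonglongrightarrow> 0"
    by (simp flip: lam_eq)

  have \<theta>: "0 \<le> \<theta> m i \<and>
      real m * (\<theta> m i / \<sigma>\<^sup>2) \<le> (1 + \<theta> m i / \<sigma>\<^sup>2) * (real n + lam n / \<sigma>\<^sup>2 * real m)"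
    if m: "m \<ge> 1" for m n
  proof -
    obtain \<eta> where \<eta>: "is_eigenbasis (e m) (measure_adj (D m) \<circ> measure_op (D m)) \<eta>"
      using assms(10)[OF m] by blast
    note bound = optimal_exchange_bound[OF F \<sigma> \<Gamma> assms(7)[OF m] assms(9)[OF m] assms(8) lam_pos \<eta>, of i]
    have T: "pushforward_cov F \<Gamma> (e m i) = lam i *\<^sub>R e m i"
      using assms(9)[OF m] by (simp add: is_eigenbasis_def)
    have N: "measure_adj (D m) (measure_op (D m) (e m i)) = \<eta> i *\<^sub>R e m i"
      using \<eta> by (simp add: is_eigenbasis_def)
    have "\<theta> m i *\<^sub>R e m i = (1 / (1 / lam i + \<eta> i / \<sigma>\<^sup>2)) *\<^sub>R e m i"
      using assms(11)[OF m] posterior_pushforward_cov_eigenvalue[OF F assms(5,6) lam_pos T bound(1) N, of \<sigma>]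
      by (simp add: is_eigenbasis_def)
    moreover have "e m i \<noteq> 0"
      using assms(9)[OF m] by (metis inner_zero_left is_eigenbasis_def orthonormal_basis_def zero_neq_one)
    ultimately have \<theta>: "\<theta> m i = 1 / (1 / lam i + \<eta> i / \<sigma>\<^sup>2)" by simp
    have "\<theta> m i / \<sigma>\<^sup>2 = lam i / \<sigma>\<^sup>2 / (1 + lam i * \<eta> i / \<sigma>\<^sup>2)"
      using lam_pos[of i] unfolding \<theta> by (simp add: field_simps)
    moreover have "0 \<le> \<theta> m i" using lam_pos[of i] bound(1) unfolding \<theta> by simp
    ultimately show ?thesis using bound(2)[of n] by simp
  qed
  show "(\<lambda>m. \<theta> m i) \<longlonglongrightarrow> 0"
  proof (rule LIMSEQ_I)
    fix r :: real assume r: "0 < r"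
    \<comment> \<open>\<open>q / (1 + q)\<close> increases with \<open>q\<close> and equals \<open>\<delta>\<close> at \<open>q = \<epsilon>\<close>\<close>
    define \<epsilon> where "\<epsilon> = r / \<sigma>\<^sup>2"
    define \<delta> where "\<delta> = \<epsilon> / (1 + \<epsilon>)"
    have \<epsilon>: "0 < \<epsilon>" using r \<sigma> by (simp add: \<epsilon>_def)
    then have \<delta>: "0 < \<delta>" by (simp add: \<delta>_def add_pos_pos)
    have "(\<lambda>n. lam n / \<sigma>\<^sup>2) \<longlonglongrightarrow> 0" using tendsto_divide[OF lam_lim tendsto_const[of "\<sigma>\<^sup>2"]] \<sigma> by simp
    then obtain n where n: "lam n / \<sigma>\<^sup>2 < \<delta> / 2"
      using order_tendstoD(2)[of _ 0 sequentially "\<delta> / 2"] \<delta>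
      by (metis (mono_tags, lifting) eventually_sequentially half_gt_zero order_refl)
    obtain M :: nat where M: "2 * real n / \<delta> < real M" using reals_Archimedean2 by blast
    have "\<theta> m i < r" if m: "m \<ge> Suc M" for m
    proof (rule ccontr)
      assume "\<not> \<theta> m i < r"
      define q where "q = \<theta> m i / \<sigma>\<^sup>2"
      have q: "\<epsilon> \<le> q" using \<open>\<not> \<theta> m i < r\<close> by (simp add: q_def \<epsilon>_def divide_right_mono)
      have "0 < real m" using m by simp
      have "2 * real n < \<delta> * real m"
      proof -
        have "2 * real n / \<delta> < real m" using M m by simp
        then show ?thesis using \<delta> by (simp add: pos_divide_less_eq mult.commute)
      qed
      moreover have "2 * (lam n / \<sigma>\<^sup>2) * real m < \<delta> * real m"
      proof (rule mult_strict_right_mono)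
        show "2 * (lam n / \<sigma>\<^sup>2) < \<delta>" using n by argo
      qed fact
      ultimately have "real n + lam n / \<sigma>\<^sup>2 * real m < \<delta> * real m" by argo
      then have "(1 + q) * (real n + lam n / \<sigma>\<^sup>2 * real m) < (1 + q) * (\<delta> * real m)"
        using q \<epsilon> by (intro mult_strict_left_mono) auto
      moreover have "real m * q \<le> (1 + q) * (real n + lam n / \<sigma>\<^sup>2 * real m)"
        using \<theta>[of m n] m by (simp add: q_def)
      ultimately have "q * real m < ((1 + q) * \<delta>) * real m" by (simp add: mult_ac)
      then have "q < (1 + q) * \<delta>" using \<open>0 < real m\<close> by (simp only: mult_less_cancel_right_pos)
      then have "q * (1 + \<epsilon>) < (1 + q) * \<epsilon>"
        using \<epsilon> by (simp add: \<delta>_def pos_less_divide_eq add_pos_pos)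
      then show False using q by (simp add: algebra_simps)
    qed
    moreover have "0 \<le> \<theta> m i" if "m \<ge> Suc M" for m using \<theta>[of m 0] that by simp
    ultimately show "\<exists>no. \<forall>m\<ge>no. norm (\<theta> m i - 0) < r" by (intro exI[of _ "Suc M"]) simp
  qed
qed

end
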